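(* Let $[X,\mathcal{B},m,\nu]$ be a reversible random walk space and let $\Omega\in\mathcal{B}$ be $m$-connected with $0<\nu(\Omega)<\nu(\Omega_m)<\infty$. For every $p>1$ such that $\Omega$ satisfies a $p$-Poincaré inequality, $$2^{p-1}\frac{h_1^m(\Omega)^p}{\nu(\Omega_m)^{p-1}}\le\frac{1}{T_{m,p}(\Omega)}\le h_p^m(\Omega).$$ Moreover, if $\Omega$ satisfies a $p$-Poincaré inequality for every $p>1$, then $$\lim_{p\to1^+}\frac{1}{T_{m,p}(\Omega)}=\lim_{p\to1^+}h_p^m(\Omega)=h_1^m(\Omega).$$
   Context: A random walk $m$ on a measurable space $(X,\mathcal{B})$ ($\mathcal{B}$ countably generated) is a family $(m_x)_{x\in X}$ of probability measures on $\mathcal{B}$ such that $x\mapsto m_x(B)$ is measurable for each $B\in\mathcal{B}$. A $\sigma$-finite measure $\nu$ on $X$ is reversible if $dm_x(y)d\nu(x)=dm_y(x)d\nu(y)$ as measures on $X\times X$; then $[X,\mathcal{B},m,\nu]$ is called a reversible random walk space. For $A,B\in\mathcal{B}$, $L_m(A,B):=\int_A m_x(B)\,d\nu(x)$, and the $m$-perimeter of $E\in\mathcal{B}$ is $P_m(E):=L_m(E,X\setminus E)$. Notation: $d(\nu\otimes m_x)(x,y)=dm_x(y)\,d\nu(x)$ and $\nabla f(x,y):=f(y)-f(x)$. For $\Omega\in\mathcal{B}$: $\partial_m\Omega:=\{x\in X\setminus\Omega: m_x(\Omega)>0\}$ and $\Omega_m:=\Omega\cup\partial_m\Omega$. A set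 $\Omega\in\mathcal B$ with $\nu(\Omega)>0$ is $m$-connected if $L_m(A,B)>0$ for all measurable $A,B\subset\Omega$ of positive $\nu$-measure with $A\cup B=\Omega$. $L^p_0(\Omega_m,\nu):=\{f\in L^p(\Omega_m,\nu): f=0\ \nu\text{-a.e. on }\partial_m\Omega\}$. $\Omega$ satisfies a $p$-Poincaré inequality if there is $\lambda>0$ with $\lambda\int_\Omega|f|^pd\nu\le\int_{\Omega_m\times\Omega_m}|\nabla f(x,y)|^p\,d(\nu\otimes m_x)(x,y)$ for all $f\in L^p_0(\Omega_m,\nu)$. The $p$-torsional function $f_{\Omega,p}\in L_0^p(\Omega_m,\nu)$ is the unique (nonnegative) solution of $-\int_{\Omega_m}|f_{\Omega,p}(y)-f_{\Omega,p}(x)|^{p-2}(f_{\Omega,p}(y)-f_{\Omega,p}(x))\,dm_x(y)=1$ for $\nu$-a.e. $x\in\Omega$, $f_{\Omega,p}=0$ on $\partial_m\Omega$; and $T_{m,p}(\Omega):=\left(\int_\Omega f_{\Omega,p}\,d\nu\right)^{p-1}$. For $p\ge1$ the ($m$-$p$-)Cheeger constant is $h_p^m(\Omega):=\inf\left\{\frac{P_m(E)}{\nu(E)^p}: E\in\mathcal{B},\ E\subset\Omega,\ \nu(E)>0\right\}$. *)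

theory Defs
  imports "HOL-Probability.Probability"
begin

text \<open>
  A measurable space \<open>(X, \<B>)\<close> equipped with a measure \<open>\<nu>\<close> is a single value \<open>\<nu> :: 'a measure\<close>, with
  \<open>X = space \<nu>\<close> and \<open>\<B> = sets \<nu>\<close>.  A random walk on it is a measurable map into \<open>prob_algebra \<nu>\<close>,
  i.e. each \<open>m x\<close> is a probability measure on \<open>\<B>\<close> and \<open>x \<mapsto> m x B\<close> is measurable for \<open>B \<in> \<B>\<close>
  (\<open>prob_algebra \<nu>\<close> depends on the \<open>\<sigma>\<close>-algebra of \<open>\<nu>\<close> only).
\<close>

definition countably_generated :: "'a measure \<Rightarrow> bool" where
  "countably_generated M \<longleftrightarrow>
     (\<exists>C. countable C \<and> C \<subseteq> Pow (space M) \<and> sets M = sigma_sets (space M) C)"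

definition random_walk :: "'a measure \<Rightarrow> ('a \<Rightarrow> 'a measure) \<Rightarrow> bool" where
  "random_walk M m \<longleftrightarrow> countably_generated M \<and> m \<in> measurable M (prob_algebra M)"

text \<open>The measure \<open>d(\<nu> \<otimes> m\<^sub>x)(x,y) = dm\<^sub>x(y) d\<nu>(x)\<close> on \<open>X \<times> X\<close>; see \<open>emeasure_walk_measure\<close> below.\<close>

definition walk_measure :: "'a measure \<Rightarrow> ('a \<Rightarrow> 'a measure) \<Rightarrow> ('a \<times> 'a) measure" where
  "walk_measure \<nu> m = \<nu> \<bind> (\<lambda>x. distr (m x) (\<nu> \<Otimes>\<^sub>M \<nu>) (Pair x))"

lemma emeasure_walk_measure:
  assumes "random_walk \<nu> m" "space \<nu> \<noteq> {}" "A \<in> sets (\<nu> \<Otimes>\<^sub>M \<nu>)"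
  shows "emeasure (walk_measure \<nu> m) A = (\<integral>\<^sup>+ x. emeasure (m x) {y. (x, y) \<in> A} \<partial>\<nu>)"
proof -
  have m[measurable]: "m \<in> measurable \<nu> (subprob_algebra \<nu>)"
    using assms(1) by (auto simp: random_walk_def intro: measurable_prob_algebraD)
  have "emeasure (walk_measure \<nu> m) A =
      (\<integral>\<^sup>+ x. emeasure (distr (m x) (\<nu> \<Otimes>\<^sub>M \<nu>) (Pair x)) A \<partial>\<nu>)"
    unfolding walk_measure_def
    by (rule emeasure_bind[OF assms(2) measurable_distr2[where M = \<nu>] assms(3)])
       (use m in \<open>simp_all add: case_prod_unfold\<close>)
  also have "\<dots> = (\<integral>\<^sup>+ x. emeasure (m x) {y. (x, y) \<in> A} \<partial>\<nu>)"
  proof (rule nn_integral_cong)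
    fix x assume x: "x \<in> space \<nu>"
    have s: "sets (m x) = sets \<nu>" using sets_kernel[OF m x] .
    have sp: "space (m x) = space \<nu>" by (rule sets_eq_imp_space_eq[OF s])
    have "Pair x \<in> measurable (m x) (\<nu> \<Otimes>\<^sub>M \<nu>)"
      using x by (simp add: measurable_cong_sets[OF s refl])
    then have "emeasure (distr (m x) (\<nu> \<Otimes>\<^sub>M \<nu>) (Pair x)) A = emeasure (m x) (Pair x -` A \<inter> space (m x))"
      using assms(3) by (rule emeasure_distr)
    also have "Pair x -` A \<inter> space (m x) = {y. (x, y) \<in> A}"
      using sets.sets_into_space[OF assms(3)] by (auto simp: sp space_pair_measure)
    finally show "emeasure (distr (m x) (\<nu> \<Otimes>\<^sub>M \<nu>) (Pair x)) A = emeasure (m x) {y. (x, y) \<in> A}" .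
  qed
  finally show ?thesis .
qed

definition reversible :: "'a measure \<Rightarrow> ('a \<Rightarrow> 'a measure) \<Rightarrow> bool" where
  "reversible \<nu> m \<longleftrightarrow>
     distr (walk_measure \<nu> m) (\<nu> \<Otimes>\<^sub>M \<nu>) (\<lambda>(x, y). (y, x)) = walk_measure \<nu> m"

definition reversible_random_walk_space :: "'a measure \<Rightarrow> ('a \<Rightarrow> 'a measure) \<Rightarrow> bool" where
  "reversible_random_walk_space \<nu> m \<longleftrightarrow>
     random_walk \<nu> m \<and> sigma_finite_measure \<nu> \<and> reversible \<nu> m"

definition interaction :: "'a measure \<Rightarrow> ('a \<Rightarrow> 'a measure) \<Rightarrow> 'a set \<Rightarrow> 'a set \<Rightarrow> ennreal" where
  "interaction \<nu> m A B = (\<integral>\<^sup>+ x \<in> A. emeasure (m x) B \<partial>\<nu>)"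

definition perimeter :: "'a measure \<Rightarrow> ('a \<Rightarrow> 'a measure) \<Rightarrow> 'a set \<Rightarrow> ennreal" where
  "perimeter \<nu> m E = interaction \<nu> m E (space \<nu> - E)"

definition m_boundary :: "'a measure \<Rightarrow> ('a \<Rightarrow> 'a measure) \<Rightarrow> 'a set \<Rightarrow> 'a set" where
  "m_boundary \<nu> m \<Omega> = {x \<in> space \<nu> - \<Omega>. emeasure (m x) \<Omega> > 0}"

definition m_closure :: "'a measure \<Rightarrow> ('a \<Rightarrow> 'a measure) \<Rightarrow> 'a set \<Rightarrow> 'a set" where
  "m_closure \<nu> m \<Omega> = \<Omega> \<union> m_boundary \<nu> m \<Omega>"

definition m_connected :: "'a measure \<Rightarrow> ('a \<Rightarrow> 'a measure) \<Rightarrow> 'a set \<Rightarrow> bool" where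
  "m_connected \<nu> m \<Omega> \<longleftrightarrow> \<Omega> \<in> sets \<nu> \<and> emeasure \<nu> \<Omega> > 0 \<and>
     (\<forall>A \<in> sets \<nu>. \<forall>B \<in> sets \<nu>.
        A \<subseteq> \<Omega> \<longrightarrow> B \<subseteq> \<Omega> \<longrightarrow> emeasure \<nu> A > 0 \<longrightarrow> emeasure \<nu> B > 0 \<longrightarrow> A \<union> B = \<Omega> \<longrightarrow>
        interaction \<nu> m A B > 0)"

text \<open>
  Elements of \<open>L\<^sup>p\<close> are represented by functions, not by equivalence classes.  For the spaces over
  \<open>\<Omega>\<^sub>m\<close> the representatives are total functions whose values outside \<open>\<Omega>\<^sub>m\<close> are unconstrained;
  everything below only looks at them on \<open>\<Omega>\<^sub>m\<close>.
\<close>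

definition Lp_fun :: "real \<Rightarrow> 'a measure \<Rightarrow> ('a \<Rightarrow> real) set" where
  "Lp_fun p M = {f \<in> borel_measurable M. integrable M (\<lambda>x. \<bar>f x\<bar> powr p)}"

definition Lp0_fun ::
  "real \<Rightarrow> 'a measure \<Rightarrow> ('a \<Rightarrow> 'a measure) \<Rightarrow> 'a set \<Rightarrow> ('a \<Rightarrow> real) set" where
  "Lp0_fun p \<nu> m \<Omega> =
     {f \<in> Lp_fun p (restrict_space \<nu> (m_closure \<nu> m \<Omega>)). AE x in \<nu>. x \<in> m_boundary \<nu> m \<Omega> \<longrightarrow> f x = 0}"

definition poincare ::
  "real \<Rightarrow> 'a measure \<Rightarrow> ('a \<Rightarrow> 'a measure) \<Rightarrow> 'a set \<Rightarrow> bool" where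
  "poincare p \<nu> m \<Omega> \<longleftrightarrow> (\<exists>c::real. c > 0 \<and> (\<forall>f \<in> Lp0_fun p \<nu> m \<Omega>.
     ennreal c * (\<integral>\<^sup>+ x \<in> \<Omega>. ennreal (\<bar>f x\<bar> powr p) \<partial>\<nu>)
       \<le> (\<integral>\<^sup>+ z \<in> m_closure \<nu> m \<Omega> \<times> m_closure \<nu> m \<Omega>.
            ennreal (\<bar>f (snd z) - f (fst z)\<bar> powr p) \<partial>(walk_measure \<nu> m))))"

text \<open>
  If the integrand in the equation is not \<open>m x\<close>-integrable, the Bochner integral is \<open>0\<close> and the
  equation fails at \<open>x\<close>, so integrability for almost every \<open>x \<in> \<Omega>\<close> is part of being a solution.
\<close>

definition is_torsional ::
  "real \<Rightarrow> 'a measure \<Rightarrow> ('a \<Rightarrow> 'a measure) \<Rightarrow> 'a set \<Rightarrow> ('a \<Rightarrow> real) \<Rightarrow> bool" where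
  "is_torsional p \<nu> m \<Omega> f \<longleftrightarrow>
     f \<in> Lp0_fun p \<nu> m \<Omega> \<and>
     (AE x in \<nu>. x \<in> m_closure \<nu> m \<Omega> \<longrightarrow> f x \<ge> 0) \<and>
     (AE x in \<nu>. x \<in> \<Omega> \<longrightarrow>
        - (LINT y : m_closure \<nu> m \<Omega> | m x. \<bar>f y - f x\<bar> powr (p - 2) * (f y - f x)) = 1)"

text \<open>
  The torsional function is unique only up to \<open>\<nu>\<close>-null sets, so \<open>SOME\<close> picks a representative.
\<close>

definition torsional_fun ::
  "real \<Rightarrow> 'a measure \<Rightarrow> ('a \<Rightarrow> 'a measure) \<Rightarrow> 'a set \<Rightarrow> 'a \<Rightarrow> real" where
  "torsional_fun p \<nu> m \<Omega> = (SOME f. is_torsional p \<nu> m \<Omega> f)"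

definition torsional_rigidity ::
  "real \<Rightarrow> 'a measure \<Rightarrow> ('a \<Rightarrow> 'a measure) \<Rightarrow> 'a set \<Rightarrow> real" where
  "torsional_rigidity p \<nu> m \<Omega> = (LINT x : \<Omega> | \<nu>. torsional_fun p \<nu> m \<Omega> x) powr (p - 1)"

text \<open>
  The Cheeger constant is real-valued and meant for \<open>\<Omega>\<close> of positive and finite measure: the infimum is then over a
  nonempty set (take \<open>E = \<Omega>\<close>), and \<open>perimeter \<nu> m E \<le> \<nu> E < \<infinity>\<close>, so \<open>enn2real\<close> is exact.
\<close>

definition cheeger ::
  "real \<Rightarrow> 'a measure \<Rightarrow> ('a \<Rightarrow> 'a measure) \<Rightarrow> 'a set \<Rightarrow> real" where
  "cheeger p \<nu> m \<Omega> =
     (INF E \<in> {E \<in> sets \<nu>. E \<subseteq> \<Omega> \<and> emeasure \<nu> E > 0}.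
        enn2real (perimeter \<nu> m E) / measure \<nu> E powr p)"

end

theory Submission
  imports Defs
begin

text \<open>
  Up to a factor, \<open>energy p u - 2 p \<integral> u\<close> is a strictly convex functional of \<open>u\<close>, coercive by the Poincare
  inequality; uniform convexity of \<open>t \<mapsto> \<bar>t\<bar>\<^sup>p\<close> makes minimizing sequences Cauchy in \<open>L\<^sup>p\<close>, so a minimizer
  exists, and its Euler--Lagrange equation is the torsion equation.  Conversely, any solution \<open>f\<close> satisfies
  \<open>energy p f = 2 \<integral> f\<close> and the weak equation.  Testing the latter with the indicator of \<open>E\<close> and using
  Hoelder's inequality bounds \<open>\<nu>(E)\<^sup>p\<close> by \<open>T P(E)\<close>, the upper bound.  For the lower bound, the coarea formula gives
  \<open>2 h \<integral> f \<le> \<integral> \<bar>\<nabla> f\<bar>\<close>, and Hoelder's inequality on the product bounds the right-hand side by the energy.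
  The limits follow by squeezing, as \<open>P(E) / \<nu>(E)\<^sup>p\<close> is continuous in \<open>p\<close> for each fixed \<open>E\<close>.
\<close>

section \<open>Convexity of the power function\<close>

text \<open>\<open>torsional_fun\<close> is a \<open>SOME\<close> term, so nothing is known about it
  until some solution exists. Once one does, the estimates use only the equation and nonnegativity
  of the chosen solution, never a description as a minimizer. Bounded minimizing sequences need not
  have norm-convergent subsequences. Comparing two near-minimizers with their midpoint gives norm
  convergence directly, without weak compactness and with one argument for p < 2 and p \<ge> 2. The
  energy lives on pairs inside the closure of \<Omega>, the perimeter on the whole space;
  reversibility makes the two agree. The powers of 2 come from symmetry: every pair is counted in
  both orders, in the energy and in the total variation alike. With S = \<integral> f and M the
  measure of the closure, Hoelder gives 2 h S \<le> (2 S)^(1/p) M^(1 - 1/p), and solving for h^p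
  leaves the factor 2^(p-1). In the upper bound the two factors cancel.\<close>

text \<open>Mean value theorem on each half of the interval: both halves have the same length, and
  the derivative p x^(p-1) is strictly larger on the right one.\<close>

lemma powr_midpoint_strict:
  fixes a b p :: real
  assumes "p > 1" "0 \<le> a" "a < b"
  shows "((a + b) / 2) powr p < (a powr p + b powr p) / 2"
proof -
  define c where "c = (a + b) / 2"
  have c: "a < c" "c < b" "c - a = b - c" using assms by (auto simp: c_def field_simps)
  have D: "((\<lambda>x. x powr p) has_real_derivative p * x powr (p - 1)) (at x)" if "x > 0" for x
    using that by (rule has_real_derivative_powr)
  have cont: "continuous_on {u..v} (\<lambda>x. x powr p)" if "0 \<le> u" for u v :: real
    using that assms by (intro continuous_on_powr' continuous_intros) auto
  obtain x where x: "a < x" "x < c" "c powr p - a powr p = (c - a) * (p * x powr (p - 1))"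
    using MVT[OF c(1) cont] D assms(2) DERIV_unique
    by (smt (verit, ccfv_SIG) real_differentiable_def)
  obtain y where y: "c < y" "y < b" "b powr p - c powr p = (b - c) * (p * y powr (p - 1))"
    using MVT[OF c(2) cont] D assms(2) c(1) DERIV_unique
    by (smt (verit, ccfv_SIG) real_differentiable_def)
  have "x powr (p - 1) < y powr (p - 1)"
    using x y assms by (intro powr_less_mono2) auto
  then have "c powr p - a powr p < b powr p - c powr p"
    using x y c assms by simp
  then show ?thesis by (simp add: c_def[symmetric])
qed

text \<open>If the moduli agree, then b = -a and the midpoint is 0. Otherwise the triangle
  inequality reduces the claim to the moduli, which are distinct.\<close>

lemma abs_powr_midpoint_strict:
  fixes a b p :: real
  assumes "p > 1" "a \<noteq> b"
  shows "\<bar>(a + b) / 2\<bar> powr p < (\<bar>a\<bar> powr p + \<bar>b\<bar> powr p) / 2"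
proof (cases "\<bar>a\<bar> = \<bar>b\<bar>")
  case True
  then have "b = - a" "a \<noteq> 0" using assms by auto
  then show ?thesis by simp
next
  case False
  have "\<bar>(a + b) / 2\<bar> powr p \<le> ((\<bar>a\<bar> + \<bar>b\<bar>) / 2) powr p"
    using assms by (intro powr_mono2) auto
  also have "\<dots> < (\<bar>a\<bar> powr p + \<bar>b\<bar> powr p) / 2"
    using False powr_midpoint_strict[of p "\<bar>a\<bar>" "\<bar>b\<bar>"] powr_midpoint_strict[of p "\<bar>b\<bar>" "\<bar>a\<bar>"] assms(1)
    by (cases "\<bar>a\<bar> < \<bar>b\<bar>") (auto simp: add.commute)
  finally show ?thesis .
qed

lemma abs_powr_midpoint:
  fixes a b p :: real
  assumes "p > 1"
  shows "\<bar>(a + b) / 2\<bar> powr p \<le> (\<bar>a\<bar> powr p + \<bar>b\<bar> powr p) / 2"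
  using abs_powr_midpoint_strict[OF assms, of a b] by (cases "a = b") auto

text \<open>All terms are homogeneous of degree p, so it suffices to look at pairs of maximum norm
  1. Pairs that are close together are absorbed by \<epsilon>; the remaining ones form a compact set
  on which the convexity gap is continuous and positive, hence bounded away from 0.\<close>

lemma abs_powr_uniformly_convex:
  fixes p \<epsilon> :: real
  assumes "p > 1" "\<epsilon> > 0"
  obtains C where "C > 0"
    "\<And>a b. \<bar>a - b\<bar> powr p \<le> \<epsilon> * (\<bar>a\<bar> powr p + \<bar>b\<bar> powr p)
        + C * ((\<bar>a\<bar> powr p + \<bar>b\<bar> powr p) / 2 - \<bar>(a + b) / 2\<bar> powr p)"
proof -
  define gap :: "real \<times> real \<Rightarrow> real"
    where "gap z = (\<bar>fst z\<bar> powr p + \<bar>snd z\<bar> powr p) / 2 - \<bar>(fst z + snd z) / 2\<bar> powr p" for z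
  define K :: "(real \<times> real) set"
    where "K = {z. max \<bar>fst z\<bar> \<bar>snd z\<bar> = 1 \<and> \<epsilon> \<le> \<bar>fst z - snd z\<bar> powr p}"
  have gap_cont: "continuous_on K gap"
    unfolding gap_def using assms by (intro continuous_intros continuous_on_powr') auto
  have "closed K"
    unfolding K_def using assms
    by (intro closed_Collect_conj closed_Collect_eq closed_Collect_le continuous_intros continuous_on_powr') auto
  moreover have "K \<subseteq> cbox (-1, -1) (1, 1)"
    by (auto simp: K_def cbox_Pair_eq max_def abs_le_iff split: if_splits)
  ultimately have "compact K"
    using bounded_subset[OF bounded_cbox] compact_eq_bounded_closed by blast
  have gap_pos: "gap z > 0" if "z \<in> K" for z
    using that assms abs_powr_midpoint_strict[OF assms(1), of "fst z" "snd z"]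
    by (cases "fst z = snd z") (auto simp: K_def gap_def)
  obtain \<delta> where \<delta>: "\<delta> > 0" "\<And>z. z \<in> K \<Longrightarrow> \<delta> \<le> gap z"
  proof (cases "K = {}")
    \<comment> \<open>For \<epsilon> > 2^p no pair of maximum norm 1 is far enough apart, and any
      \<delta> will do.\<close>
    case True
    then show ?thesis using that[of 1] by auto
  next
    case False
    then obtain z where "z \<in> K" "\<And>w. w \<in> K \<Longrightarrow> gap z \<le> gap w"
      using continuous_attains_inf[OF \<open>compact K\<close> False gap_cont] by auto
    then show ?thesis using that[of "gap z"] gap_pos by auto
  qed
  show ?thesis
  \<comment> \<open>With r the larger modulus, the left side is at most (2 r)^p, while by scaling
    the gap is at least \<delta> r^p whenever the scaled pair lies in \<open>K\<close>.\<close>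
  proof (rule that[of "2 powr p / \<delta>"])
    show "2 powr p / \<delta> > 0" using \<delta> by simp
    fix a b :: real
    define r where "r = max \<bar>a\<bar> \<bar>b\<bar>"
    have gap0: "gap (a, b) \<ge> 0"
      using abs_powr_midpoint[OF assms(1), of a b] by (simp add: gap_def)
    have "\<bar>a - b\<bar> powr p \<le> \<epsilon> * (\<bar>a\<bar> powr p + \<bar>b\<bar> powr p) + 2 powr p / \<delta> * gap (a, b)"
    proof (cases "r = 0")
      case True
      then show ?thesis by (auto simp: r_def max_def gap_def split: if_splits)
    next
      case False
      then have r: "r > 0" by (auto simp: r_def max_def)
      have rp: "r powr p \<le> \<bar>a\<bar> powr p + \<bar>b\<bar> powr p" by (auto simp: r_def max_def)
      have sc: "\<bar>x / r\<bar> powr p = \<bar>x\<bar> powr p / r powr p" for x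
        using r by (simp add: powr_divide)
      have sub: "\<bar>a / r - b / r\<bar> powr p = \<bar>a - b\<bar> powr p / r powr p"
        using sc[of "a - b"] by (simp add: diff_divide_distrib)
      have add: "\<bar>(a / r + b / r) / 2\<bar> powr p = \<bar>(a + b) / 2\<bar> powr p / r powr p"
        using sc[of "(a + b) / 2"] by (simp add: add_divide_distrib mult.commute)
      have max1: "max \<bar>a / r\<bar> \<bar>b / r\<bar> = 1"
        using r by (auto simp: r_def max_def divide_simps)
      show ?thesis
      proof (cases "\<epsilon> \<le> \<bar>a / r - b / r\<bar> powr p")
        case True
        then have "\<delta> \<le> gap (a / r, b / r)"
          using max1 by (intro \<delta>(2)) (simp add: K_def)
        also have "\<dots> = gap (a, b) / r powr p"
          unfolding gap_def fst_conv snd_conv add sc by (simp add: add_divide_distrib diff_divide_distrib)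
        finally have "\<delta> * r powr p \<le> gap (a, b)" using r by (simp add: field_simps)
        then have "2 powr p / \<delta> * (\<delta> * r powr p) \<le> 2 powr p / \<delta> * gap (a, b)"
          using \<delta> by (intro mult_left_mono) auto
        then have "(2 * r) powr p \<le> 2 powr p / \<delta> * gap (a, b)"
          using \<delta> r by (simp add: powr_mult)
        moreover have "\<bar>a - b\<bar> powr p \<le> (2 * r) powr p"
          using assms by (intro powr_mono2) (auto simp: r_def max_def)
        moreover have "0 \<le> \<epsilon> * (\<bar>a\<bar> powr p + \<bar>b\<bar> powr p)" using assms by simp
        ultimately show ?thesis by linarith
      next
        case False
        then have "\<bar>a - b\<bar> powr p / r powr p \<le> \<epsilon>"
          unfolding sub by simp
        then have "\<bar>a - b\<bar> powr p \<le> \<epsilon> * r powr p"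
          using r by (simp add: field_simps)
        also have "\<dots> \<le> \<epsilon> * (\<bar>a\<bar> powr p + \<bar>b\<bar> powr p)"
          using assms rp by simp
        finally show ?thesis using gap0 \<delta>(1) by (simp add: add_increasing2)
      qed
    qed
    then show "\<bar>a - b\<bar> powr p \<le> \<epsilon> * (\<bar>a\<bar> powr p + \<bar>b\<bar> powr p)
        + 2 powr p / \<delta> * ((\<bar>a\<bar> powr p + \<bar>b\<bar> powr p) / 2 - \<bar>(a + b) / 2\<bar> powr p)"
      by (simp add: gap_def)
  qed
qed

section \<open>Growth, derivative and Young inequalities for the p-th power\<close>

lemma abs_powr_add_le:
  fixes a b p :: real
  assumes "p > 0"
  shows "(\<bar>a\<bar> + \<bar>b\<bar>) powr p \<le> 2 powr p * (\<bar>a\<bar> powr p + \<bar>b\<bar> powr p)"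
proof -
  have "(\<bar>a\<bar> + \<bar>b\<bar>) powr p \<le> (2 * max \<bar>a\<bar> \<bar>b\<bar>) powr p"
    using assms by (intro powr_mono2) auto
  also have "\<dots> = 2 powr p * max \<bar>a\<bar> \<bar>b\<bar> powr p" by (simp add: powr_mult max_def)
  also have "\<dots> \<le> 2 powr p * (\<bar>a\<bar> powr p + \<bar>b\<bar> powr p)" by (intro mult_left_mono) (auto simp: max_def)
  finally show ?thesis .
qed

lemma abs_powr_diff_le:
  fixes a b p :: real
  assumes "p > 0"
  shows "\<bar>a - b\<bar> powr p \<le> 2 powr p * (\<bar>a\<bar> powr p + \<bar>b\<bar> powr p)"
proof -
  have "\<bar>a - b\<bar> powr p \<le> (\<bar>a\<bar> + \<bar>b\<bar>) powr p" using assms by (intro powr_mono2) auto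
  then show ?thesis using abs_powr_add_le[OF assms, of a b] by linarith
qed

text \<open>At 0 the difference quotient is of size |h|^(p-1), which tends to 0 because p > 1. There
  the derivative formula also gives 0, even for p < 2, owing to the factor x.\<close>

lemma DERIV_abs_powr:
  fixes x p :: real
  assumes "p > 1"
  shows "((\<lambda>x. \<bar>x\<bar> powr p) has_real_derivative p * (\<bar>x\<bar> powr (p - 2) * x)) (at x)"
proof (cases "x = 0")
  case True
  have "((\<lambda>h. \<bar>h\<bar> powr (p - 1)) \<longlongrightarrow> \<bar>0\<bar> powr (p - 1)) (at (0::real))"
    using assms by (intro tendsto_intros tendsto_powr') auto
  then have "((\<lambda>h. \<bar>h\<bar> powr (p - 1)) \<longlongrightarrow> 0) (at (0::real))" by simp
  then have "((\<lambda>h. \<bar>0 + h\<bar> powr p / h) \<longlongrightarrow> 0) (at (0::real))"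
  proof (rule Lim_null_comparison[rotated])
    show "\<forall>\<^sub>F h in at 0. norm (\<bar>0 + h\<bar> powr p / h) \<le> \<bar>h\<bar> powr (p - 1)"
      by (rule eventually_at_filter[THEN iffD2], rule always_eventually) (auto simp: powr_diff)
  qed
  then show ?thesis using True by (simp add: DERIV_def)
next
  case False
  have "((\<lambda>x. \<bar>x\<bar> powr p) has_real_derivative p * \<bar>x\<bar> powr (p - 1) * sgn x) (at x)"
  proof (cases "x > 0")
    case True
    then have "((\<lambda>x. x powr p) has_real_derivative p * \<bar>x\<bar> powr (p - 1) * sgn x) (at x)"
      by (auto intro!: derivative_eq_intros)
    then show ?thesis
      by (rule has_field_derivative_transform_within_open[where S = "{0<..}"]) (use True in auto)
  next
    case neg: False
    then have "((\<lambda>x. (- x) powr p) has_real_derivative p * \<bar>x\<bar> powr (p - 1) * sgn x) (at x)"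
      using False by (auto intro!: derivative_eq_intros simp: powr_diff)
    then show ?thesis
      by (rule has_field_derivative_transform_within_open[where S = "{..<0}"]) (use neg False in auto)
  qed
  moreover have "\<bar>x\<bar> powr (p - 1) * sgn x = \<bar>x\<bar> powr (p - 2) * x"
    using False by (auto simp: powr_diff sgn_if field_simps power2_eq_square)
  ultimately show ?thesis by (simp add: mult.assoc)
qed

lemma abs_powr_mult_self: "\<bar>\<bar>s\<bar> powr (p - 2) * s\<bar> = \<bar>s\<bar> powr (p - 1)" for s p :: real
  by (cases "s = 0") (auto simp: abs_mult powr_diff field_simps power2_eq_square)

text \<open>Mean value inequality on the ball of radius |h| around a. It supplies the integrable
  majorant when the energy is differentiated under the integral.\<close>

lemma abs_powr_diff_quot_le:
  fixes a h p :: real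
  assumes "p > 1"
  shows "\<bar>\<bar>a + h\<bar> powr p - \<bar>a\<bar> powr p\<bar> \<le> p * \<bar>h\<bar> * (\<bar>a\<bar> + \<bar>h\<bar>) powr (p - 1)"
proof -
  have "norm (\<bar>a + h\<bar> powr p - \<bar>a\<bar> powr p) \<le> (p * (\<bar>a\<bar> + \<bar>h\<bar>) powr (p - 1)) * norm (a + h - a)"
  proof (rule differentiable_bound[of "cball a \<bar>h\<bar>" _ "\<lambda>x d. p * (\<bar>x\<bar> powr (p - 2) * x) * d"])
    fix x assume x: "x \<in> cball a \<bar>h\<bar>"
    show "((\<lambda>x. \<bar>x\<bar> powr p) has_derivative (\<lambda>d. p * (\<bar>x\<bar> powr (p - 2) * x) * d)) (at x within cball a \<bar>h\<bar>)"
      using DERIV_abs_powr[OF assms, of x]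
      by (auto simp: has_field_derivative_def intro: has_derivative_at_withinI)
    have "onorm (\<lambda>d. p * (\<bar>x\<bar> powr (p - 2) * x) * d) \<le> \<bar>p * (\<bar>x\<bar> powr (p - 2) * x)\<bar>"
      by (intro onorm_le) (simp add: abs_mult)
    also have "\<dots> = p * \<bar>x\<bar> powr (p - 1)"
      using assms abs_powr_mult_self[of x p] by (subst abs_mult) simp
    also have "\<dots> \<le> p * (\<bar>a\<bar> + \<bar>h\<bar>) powr (p - 1)"
      using assms x by (intro mult_left_mono powr_mono2) (auto simp: dist_real_def)
    finally show "onorm (\<lambda>d. p * (\<bar>x\<bar> powr (p - 2) * x) * d) \<le> p * (\<bar>a\<bar> + \<bar>h\<bar>) powr (p - 1)" .
  qed (auto simp: dist_real_def)
  then show ?thesis by (simp add: mult_ac)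
qed

text \<open>Young's inequality for t and s^(p-1) with exponents p and p/(p-1). Integrated after a
  suitable rescaling of one factor, it does the work of Hoelder's inequality in both Cheeger
  bounds.\<close>

lemma Young_powr:
  fixes s t p :: real
  assumes "p > 1" "s \<ge> 0" "t \<ge> 0"
  shows "s powr (p - 1) * t \<le> (1 - 1 / p) * s powr p + t powr p / p"
proof -
  have "t * s powr (p - 1) \<le> t powr p / p + (s powr (p - 1)) powr (p / (p - 1)) / (p / (p - 1))"
    using assms by (intro Youngs_inequality) (auto simp: divide_simps)
  also have "(s powr (p - 1)) powr (p / (p - 1)) = s powr p"
    using assms by (simp add: powr_powr)
  finally show ?thesis using assms by (simp add: field_simps)
qed

text \<open>The constant is the threshold beyond which \<delta> |t|^(p-1) \<ge> 1. On sets of finite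
  measure this controls L^1 by L^p with a freely chosen weight \<delta>.\<close>

lemma abs_le_powr_plus:
  fixes t p \<delta> :: real
  assumes "p > 1" "\<delta> > 0"
  shows "\<bar>t\<bar> \<le> \<delta> * \<bar>t\<bar> powr p + (1 / \<delta>) powr (1 / (p - 1))"
proof (cases "\<bar>t\<bar> \<le> (1 / \<delta>) powr (1 / (p - 1))")
  case True
  then show ?thesis using assms by (simp add: add_increasing)
next
  case False
  then have "((1 / \<delta>) powr (1 / (p - 1))) powr (p - 1) \<le> \<bar>t\<bar> powr (p - 1)"
    using assms by (intro powr_mono2) auto
  then have "1 \<le> \<delta> * \<bar>t\<bar> powr (p - 1)"
    using assms by (simp add: powr_powr field_simps)
  then have "\<bar>t\<bar> * 1 \<le> \<bar>t\<bar> * (\<delta> * \<bar>t\<bar> powr (p - 1))" by (intro mult_left_mono) auto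
  also have "\<dots> = \<delta> * \<bar>t\<bar> powr p" by (cases "t = 0") (auto simp: powr_diff)
  finally show ?thesis by (simp add: add_increasing2)
qed

section \<open>The walk restricted to the closure of a domain\<close>

locale walk_domain =
  fixes \<nu> :: "'a measure" and m :: "'a \<Rightarrow> 'a measure" and \<Omega> :: "'a set"
  assumes rw: "random_walk \<nu> m" and rev: "reversible \<nu> m" and sf: "sigma_finite_measure \<nu>"
    and \<Omega>_sets[measurable]: "\<Omega> \<in> sets \<nu>"
    and \<Omega>_pos: "0 < emeasure \<nu> \<Omega>"
    and closure_fin: "emeasure \<nu> (m_closure \<nu> m \<Omega>) < \<infinity>"
begin

abbreviation "W \<equiv> walk_measure \<nu> m"
abbreviation "D \<equiv> m_closure \<nu> m \<Omega>"

text \<open>The measure against which the right-hand side of the Poincare inequality integrates.\<close>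

definition \<mu> :: "('a \<times> 'a) measure" where "\<mu> = density W (indicator (D \<times> D))"

lemma m_sub[measurable]: "m \<in> measurable \<nu> (subprob_algebra \<nu>)"
  using rw by (auto simp: random_walk_def intro: measurable_prob_algebraD)

lemma space_nonempty: "space \<nu> \<noteq> {}"
  using \<Omega>_pos sets.sets_into_space[OF \<Omega>_sets] by (metis less_irrefl emeasure_empty subset_empty)

lemma sets_m: "x \<in> space \<nu> \<Longrightarrow> sets (m x) = sets \<nu>"
  by (rule sets_kernel[OF m_sub])

lemma space_m: "x \<in> space \<nu> \<Longrightarrow> space (m x) = space \<nu>"
  using sets_m sets_eq_imp_space_eq by blast

lemma borel_measurable_m: "x \<in> space \<nu> \<Longrightarrow> f \<in> borel_measurable \<nu> \<Longrightarrow> f \<in> borel_measurable (m x)"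
  using measurable_cong_sets[OF sets_m refl] by blast

lemma prob_m: "x \<in> space \<nu> \<Longrightarrow> prob_space (m x)"
  using rw measurable_space[of m \<nu> "prob_algebra \<nu>" x]
  by (auto simp: random_walk_def space_prob_algebra)

lemma D_sets[measurable]: "D \<in> sets \<nu>"
proof -
  have "m_boundary \<nu> m \<Omega> \<in> sets \<nu>"
    unfolding m_boundary_def by measurable
  then show ?thesis by (auto simp: m_closure_def)
qed

lemma \<Omega>_D: "\<Omega> \<subseteq> D" by (auto simp: m_closure_def)

lemma \<Omega>_fin: "emeasure \<nu> \<Omega> < \<infinity>"
  using emeasure_mono[OF \<Omega>_D D_sets] closure_fin by (rule le_less_trans)

lemma sets_W[simp, measurable_cong]: "sets W = sets (\<nu> \<Otimes>\<^sub>M \<nu>)"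
  unfolding walk_measure_def by (rule sets_bind[OF _ space_nonempty]) simp

lemma sets_\<mu>[simp, measurable_cong]: "sets \<mu> = sets (\<nu> \<Otimes>\<^sub>M \<nu>)"
  by (simp add: \<mu>_def)

lemma space_\<mu>[simp]: "space \<mu> = space \<nu> \<times> space \<nu>"
  using sets_eq_imp_space_eq[OF sets_\<mu>] by (simp add: space_pair_measure)

lemma measurable_distr_Pair:
  "(\<lambda>x. distr (m x) (\<nu> \<Otimes>\<^sub>M \<nu>) (Pair x)) \<in> measurable \<nu> (subprob_algebra (\<nu> \<Otimes>\<^sub>M \<nu>))"
  by (rule measurable_distr2[where M = \<nu>]) (simp_all add: case_prod_unfold)

lemma measurable_Pair_m: "x \<in> space \<nu> \<Longrightarrow> Pair x \<in> measurable (m x) (\<nu> \<Otimes>\<^sub>M \<nu>)"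
  by (simp add: measurable_cong_sets[OF sets_m refl])

text \<open>The integrand itself depends on x. Pushing \<open>m x\<close> forward along
  \<open>Pair x\<close> moves this dependence into the measure, so that one fixed function is
  integrated against a measurable family.\<close>

lemma borel_measurable_integral_kernel:
  fixes f :: "'a \<Rightarrow> 'a \<Rightarrow> real"
  assumes [measurable]: "(\<lambda>(x, y). f x y) \<in> borel_measurable (\<nu> \<Otimes>\<^sub>M \<nu>)"
  shows "(\<lambda>x. \<integral> y. f x y \<partial>m x) \<in> borel_measurable \<nu>"
proof (subst measurable_cong)
  fix x assume "x \<in> space \<nu>"
  then show "(\<integral> y. f x y \<partial>m x) = (\<integral> (x, y). f x y \<partial>distr (m x) (\<nu> \<Otimes>\<^sub>M \<nu>) (Pair x))"
    by (subst integral_distr[OF measurable_Pair_m]) auto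
next
  show "(\<lambda>x. \<integral> (x, y). f x y \<partial>distr (m x) (\<nu> \<Otimes>\<^sub>M \<nu>) (Pair x)) \<in> borel_measurable \<nu>"
    by (rule measurable_compose[OF measurable_distr_Pair integral_measurable_subprob_algebra]) fact
qed

section \<open>Iterated integrals, symmetry and marginals of the walk measure\<close>

lemma nn_integral_W:
  assumes f[measurable]: "f \<in> borel_measurable (\<nu> \<Otimes>\<^sub>M \<nu>)"
  shows "(\<integral>\<^sup>+ z. f z \<partial>W) = (\<integral>\<^sup>+ x. \<integral>\<^sup>+ y. f (x, y) \<partial>m x \<partial>\<nu>)"
proof -
  have "(\<integral>\<^sup>+ z. f z \<partial>W) = (\<integral>\<^sup>+ x. \<integral>\<^sup>+ z. f z \<partial>distr (m x) (\<nu> \<Otimes>\<^sub>M \<nu>) (Pair x) \<partial>\<nu>)"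
    unfolding walk_measure_def by (rule nn_integral_bind[OF f measurable_distr_Pair])
  also have "\<dots> = (\<integral>\<^sup>+ x. \<integral>\<^sup>+ y. f (x, y) \<partial>m x \<partial>\<nu>)"
  proof (rule nn_integral_cong)
    fix x assume x: "x \<in> space \<nu>"
    then show "(\<integral>\<^sup>+ z. f z \<partial>distr (m x) (\<nu> \<Otimes>\<^sub>M \<nu>) (Pair x)) = (\<integral>\<^sup>+ y. f (x, y) \<partial>m x)"
      by (intro nn_integral_distr measurable_Pair_m) (simp_all add: f)
  qed
  finally show ?thesis .
qed

lemma nn_integral_W_swap:
  assumes f[measurable]: "f \<in> borel_measurable (\<nu> \<Otimes>\<^sub>M \<nu>)"
  shows "(\<integral>\<^sup>+ z. f (snd z, fst z) \<partial>W) = (\<integral>\<^sup>+ z. f z \<partial>W)"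
proof -
  have "(\<integral>\<^sup>+ z. f z \<partial>W) = (\<integral>\<^sup>+ z. f z \<partial>distr W (\<nu> \<Otimes>\<^sub>M \<nu>) (\<lambda>(x, y). (y, x)))"
    using rev by (simp add: reversible_def)
  also have "\<dots> = (\<integral>\<^sup>+ z. f (snd z, fst z) \<partial>W)"
    by (subst nn_integral_distr) (auto simp: case_prod_unfold)
  finally show ?thesis by simp
qed

lemma nn_integral_\<mu>:
  assumes [measurable]: "f \<in> borel_measurable (\<nu> \<Otimes>\<^sub>M \<nu>)"
  shows "(\<integral>\<^sup>+ z. f z \<partial>\<mu>) = (\<integral>\<^sup>+ z \<in> D \<times> D. f z \<partial>W)"
  unfolding \<mu>_def by (subst nn_integral_density) (auto simp: mult.commute)

lemma nn_integral_\<mu>_iterated: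
  assumes [measurable]: "f \<in> borel_measurable (\<nu> \<Otimes>\<^sub>M \<nu>)"
  shows "(\<integral>\<^sup>+ z. f z \<partial>\<mu>) = (\<integral>\<^sup>+ x \<in> D. (\<integral>\<^sup>+ y \<in> D. f (x, y) \<partial>m x) \<partial>\<nu>)"
proof -
  have "(\<integral>\<^sup>+ z. f z \<partial>\<mu>) = (\<integral>\<^sup>+ x. \<integral>\<^sup>+ y. f (x, y) * indicator (D \<times> D) (x, y) \<partial>m x \<partial>\<nu>)"
    by (simp add: nn_integral_\<mu> nn_integral_W)
  also have "\<dots> = (\<integral>\<^sup>+ x \<in> D. (\<integral>\<^sup>+ y \<in> D. f (x, y) \<partial>m x) \<partial>\<nu>)"
    by (intro nn_integral_cong) (auto split: split_indicator simp: indicator_times)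
  finally show ?thesis .
qed

lemma nn_integral_\<mu>_swap:
  assumes [measurable]: "f \<in> borel_measurable (\<nu> \<Otimes>\<^sub>M \<nu>)"
  shows "(\<integral>\<^sup>+ z. f (snd z, fst z) \<partial>\<mu>) = (\<integral>\<^sup>+ z. f z \<partial>\<mu>)"
proof -
  have "(\<integral>\<^sup>+ z. f (snd z, fst z) \<partial>\<mu>) = (\<integral>\<^sup>+ z. (\<lambda>z. f z * indicator (D \<times> D) z) (snd z, fst z) \<partial>W)"
    by (subst nn_integral_\<mu>) (auto intro!: nn_integral_cong split: split_indicator)
  also have "\<dots> = (\<integral>\<^sup>+ z. f z \<partial>\<mu>)"
    by (subst nn_integral_W_swap) (auto simp: nn_integral_\<mu>)
  finally show ?thesis .
qed

text \<open>The first marginal of \<mu> has density m_x(D) \<le> 1 with respect to \<nu> on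
  \<open>D\<close>. Finiteness of \<mu> and the transfer of integrability and of null sets from
  \<nu> to \<mu> all rest on this.\<close>

lemma nn_integral_\<mu>_fst_le:
  assumes [measurable]: "g \<in> borel_measurable \<nu>"
  shows "(\<integral>\<^sup>+ z. g (fst z) \<partial>\<mu>) \<le> (\<integral>\<^sup>+ x \<in> D. g x \<partial>\<nu>)"
proof -
  have "(\<integral>\<^sup>+ z. g (fst z) \<partial>\<mu>) = (\<integral>\<^sup>+ x \<in> D. (\<integral>\<^sup>+ y \<in> D. g x \<partial>m x) \<partial>\<nu>)"
    by (subst nn_integral_\<mu>_iterated) auto
  also have "\<dots> \<le> (\<integral>\<^sup>+ x \<in> D. g x \<partial>\<nu>)"
  proof (intro nn_integral_mono mult_right_mono)
    fix x assume x: "x \<in> space \<nu>"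
    interpret prob_space "m x" by (rule prob_m[OF x])
    have "(\<integral>\<^sup>+ y \<in> D. g x \<partial>m x) \<le> (\<integral>\<^sup>+ y. g x \<partial>m x)"
      by (intro nn_integral_mono) (auto split: split_indicator)
    also have "\<dots> = g x" by (simp add: emeasure_space_1)
    finally show "(\<integral>\<^sup>+ y \<in> D. g x \<partial>m x) \<le> g x" .
  qed auto
  finally show ?thesis .
qed

lemma nn_integral_\<mu>_snd_le:
  assumes [measurable]: "g \<in> borel_measurable \<nu>"
  shows "(\<integral>\<^sup>+ z. g (snd z) \<partial>\<mu>) \<le> (\<integral>\<^sup>+ x \<in> D. g x \<partial>\<nu>)"
  using nn_integral_\<mu>_swap[of "\<lambda>z. g (fst z)"] nn_integral_\<mu>_fst_le[OF assms] by simp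

lemma emeasure_\<mu>_le: "emeasure \<mu> (space \<mu>) \<le> emeasure \<nu> D"
  using nn_integral_\<mu>_fst_le[of "\<lambda>_. 1"] by simp

sublocale \<mu>: finite_measure \<mu>
  using emeasure_\<mu>_le closure_fin by (intro finite_measureI) (auto simp: top_unique)

lemma measure_\<mu>_le: "measure \<mu> (space \<mu>) \<le> measure \<nu> D"
  unfolding measure_def using emeasure_\<mu>_le closure_fin by (intro enn2real_mono) auto

lemma integral_\<mu>_swap:
  fixes f :: "'a \<times> 'a \<Rightarrow> real"
  assumes [measurable]: "f \<in> borel_measurable (\<nu> \<Otimes>\<^sub>M \<nu>)"
  shows "(\<integral> z. f (snd z, fst z) \<partial>\<mu>) = (\<integral> z. f z \<partial>\<mu>)"
    and "integrable \<mu> (\<lambda>z. f (snd z, fst z)) \<longleftrightarrow> integrable \<mu> f"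
proof -
  have "distr \<mu> (\<nu> \<Otimes>\<^sub>M \<nu>) (\<lambda>z. (snd z, fst z)) = \<mu>"
  proof (rule measure_eqI)
    fix A assume A: "A \<in> sets (distr \<mu> (\<nu> \<Otimes>\<^sub>M \<nu>) (\<lambda>z. (snd z, fst z)))"
    then have A'[measurable]: "A \<in> sets (\<nu> \<Otimes>\<^sub>M \<nu>)" by simp
    have "emeasure (distr \<mu> (\<nu> \<Otimes>\<^sub>M \<nu>) (\<lambda>z. (snd z, fst z))) A
        = (\<integral>\<^sup>+ z. indicator A z \<partial>distr \<mu> (\<nu> \<Otimes>\<^sub>M \<nu>) (\<lambda>z. (snd z, fst z)))" by simp
    also have "\<dots> = (\<integral>\<^sup>+ z. indicator A (snd z, fst z) \<partial>\<mu>)" by (subst nn_integral_distr) auto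
    also have "\<dots> = (\<integral>\<^sup>+ z. indicator A z \<partial>\<mu>)" by (rule nn_integral_\<mu>_swap) simp
    finally show "emeasure (distr \<mu> (\<nu> \<Otimes>\<^sub>M \<nu>) (\<lambda>z. (snd z, fst z))) A = emeasure \<mu> A" by simp
  qed simp
  note eq = this
  show "(\<integral> z. f (snd z, fst z) \<partial>\<mu>) = (\<integral> z. f z \<partial>\<mu>)"
    by (subst (2) eq[symmetric], subst integral_distr) auto
  show "integrable \<mu> (\<lambda>z. f (snd z, fst z)) \<longleftrightarrow> integrable \<mu> f"
    by (subst (2) eq[symmetric], subst integrable_distr_eq) auto
qed

text \<open>Both marginals of \<mu> are dominated by \<nu>, so a \<nu>-null set is \<mu>-null in
  either coordinate. This carries a.e. convergence of functions over to their differences.\<close>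

lemma AE_\<mu>_fst_snd:
  assumes "AE x in \<nu>. P x"
  shows "AE z in \<mu>. P (fst z) \<and> P (snd z)"
proof -
  obtain N where N: "N \<in> sets \<nu>" "emeasure \<nu> N = 0" "{x \<in> space \<nu>. \<not> P x} \<subseteq> N"
    using assms by (auto elim!: AE_E)
  have N_meas[measurable]: "N \<in> sets \<nu>" by fact
  have le: "(\<integral>\<^sup>+ x \<in> D. indicator N x \<partial>\<nu>) \<le> 0"
    using emeasure_mono[of "N \<inter> D" N \<nu>] N by (simp add: nn_integral_set_ennreal[symmetric] indicator_inter_arith[symmetric])
  have "AE z in \<mu>. fst z \<notin> N" "AE z in \<mu>. snd z \<notin> N"
  proof -
    have "(\<integral>\<^sup>+ z. indicator N (fst z) \<partial>\<mu>) = 0"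
      using nn_integral_\<mu>_fst_le[of "indicator N"] le by simp
    then show "AE z in \<mu>. fst z \<notin> N"
      by (subst (asm) nn_integral_0_iff_AE) (auto simp: indicator_eq_0_iff)
    have "(\<integral>\<^sup>+ z. indicator N (snd z) \<partial>\<mu>) = 0"
      using nn_integral_\<mu>_snd_le[of "indicator N"] le by simp
    then show "AE z in \<mu>. snd z \<notin> N"
      by (subst (asm) nn_integral_0_iff_AE) (auto simp: indicator_eq_0_iff)
  qed
  moreover have "AE z in \<mu>. z \<in> space \<nu> \<times> space \<nu>"
    using AE_space[of \<mu>] by simp
  ultimately show ?thesis
    by eventually_elim (use N(3) in auto)
qed

text \<open>A single measure \<open>m x\<close> may charge a \<nu>-null set, but integrating over x
  shows that inside \<open>D\<close> this happens only for a null set of x. Changing a function on a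
  null set therefore preserves the torsion equation a.e., although that equation sees the function
  through \<open>m x\<close>.\<close>

lemma AE_m:
  assumes "AE x in \<nu>. P x"
  shows "AE x in \<nu>. x \<in> D \<longrightarrow> (AE y in m x. y \<in> D \<longrightarrow> P y)"
proof -
  obtain N where N: "N \<in> sets \<nu>" "emeasure \<nu> N = 0" "{x \<in> space \<nu>. \<not> P x} \<subseteq> N"
    using assms by (auto elim!: AE_E)
  have N_meas[measurable]: "N \<in> sets \<nu>" by fact
  have "AE z in \<mu>. snd z \<notin> N"
    using AE_\<mu>_fst_snd[OF AE_not_in[OF null_setsI[OF N(2,1)]]] by auto
  then have "(\<integral>\<^sup>+ z. indicator N (snd z) \<partial>\<mu>) = 0"
    by (subst nn_integral_0_iff_AE) (auto simp: indicator_eq_0_iff)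
  then have "(\<integral>\<^sup>+ x \<in> D. (\<integral>\<^sup>+ y \<in> D. indicator N y \<partial>m x) \<partial>\<nu>) = 0"
    by (subst (asm) nn_integral_\<mu>_iterated) auto
  then have "AE x in \<nu>. (\<integral>\<^sup>+ y \<in> D. indicator N y \<partial>m x) * indicator D x = 0"
    by (subst (asm) nn_integral_0_iff_AE) auto
  then show ?thesis
    using AE_space
  proof eventually_elim
    fix x assume *: "(\<integral>\<^sup>+ y \<in> D. indicator N y \<partial>m x) * indicator D x = 0" and x: "x \<in> space \<nu>"
    show "x \<in> D \<longrightarrow> (AE y in m x. y \<in> D \<longrightarrow> P y)"
    proof
      assume "x \<in> D"
      then have "(\<integral>\<^sup>+ y \<in> D. indicator N y \<partial>m x) = 0" using * by simp
      then have "AE y in m x. (indicator N y * indicator D y :: ennreal) = 0"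
        by (subst (asm) nn_integral_0_iff_AE) (auto intro!: borel_measurable_m[OF x])
      then show "AE y in m x. y \<in> D \<longrightarrow> P y"
        using AE_space by eventually_elim (use N(3) in \<open>auto simp: space_m[OF x] split: split_indicator_asm\<close>)
    qed
  qed
qed

text \<open>Fubini's theorem for a kernel measure, which is not a product: it is reduced to
  nonnegative integrals of the positive and negative parts, both finite for a.e. x.\<close>

lemma integral_\<mu>_iterated:
  fixes g :: "'a \<times> 'a \<Rightarrow> real"
  assumes g: "integrable \<mu> g"
  shows "AE x in \<nu>. x \<in> D \<longrightarrow> set_integrable (m x) D (\<lambda>y. g (x, y))"
    and "integrable \<nu> (\<lambda>x. indicator D x * (LINT y : D | m x. g (x, y)))"
    and "(\<integral> z. g z \<partial>\<mu>) = (\<integral> x. indicator D x * (LINT y : D | m x. g (x, y)) \<partial>\<nu>)"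
proof -
  have [measurable]: "g \<in> borel_measurable (\<nu> \<Otimes>\<^sub>M \<nu>)"
    using borel_measurable_integrable[OF g] by (simp cong: measurable_cong_sets)
  \<comment> \<open>\<open>ennreal\<close> truncates negative values to 0, so s = 1 and s = -1 pick
    out the positive and the negative part of \<open>g\<close>.\<close>
  define P where "P s x = (\<integral>\<^sup>+ y \<in> D. ennreal (s * g (x, y)) \<partial>m x) * indicator D x" for s x
  have P_meas[measurable]: "P s \<in> borel_measurable \<nu>" for s
    unfolding P_def
    by (intro borel_measurable_times_ennreal nn_integral_measurable_subprob_algebra2[where N = \<nu>]) measurable
  have int_P: "(\<integral>\<^sup>+ z. ennreal (s * g z) \<partial>\<mu>) = (\<integral>\<^sup>+ x. P s x \<partial>\<nu>)" for s
    unfolding P_def[abs_def] by (rule nn_integral_\<mu>_iterated) measurable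
  have fin: "(\<integral>\<^sup>+ x. P s x \<partial>\<nu>) < \<infinity>" for s
  proof -
    have "integrable \<mu> (\<lambda>z. s * g z)" using g by simp
    then have "(\<integral>\<^sup>+ z. ennreal (s * g z) \<partial>\<mu>) < \<infinity>"
      by (metis real_integrable_def infinity_ennreal_def less_top)
    then show ?thesis by (simp add: int_P)
  qed
  have AE_fin: "AE x in \<nu>. P s x \<noteq> \<infinity>" for s
    using fin[of s] by (intro nn_integral_PInf_AE) auto
  have ind: "ennreal (indicator D y * t) = ennreal t * indicator D y" for y t
    by (auto split: split_indicator)
  have key: "AE x in \<nu>. (x \<in> D \<longrightarrow> set_integrable (m x) D (\<lambda>y. g (x, y))) \<and>
      indicator D x * (LINT y : D | m x. g (x, y)) = enn2real (P 1 x) - enn2real (P (-1) x)"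
    using AE_fin[of 1] AE_fin[of "-1"] AE_space
  proof eventually_elim
    fix x assume f: "P 1 x \<noteq> \<infinity>" "P (-1) x \<noteq> \<infinity>" and x: "x \<in> space \<nu>"
    have meas: "(\<lambda>y. indicator D y * g (x, y)) \<in> borel_measurable (m x)"
      by (rule borel_measurable_m[OF x]) (use x in measurable)
    show "(x \<in> D \<longrightarrow> set_integrable (m x) D (\<lambda>y. g (x, y))) \<and>
      indicator D x * (LINT y : D | m x. g (x, y)) = enn2real (P 1 x) - enn2real (P (-1) x)"
    proof (cases "x \<in> D")
      case True
      have e: "ennreal (- (indicator D y * g (x, y))) = ennreal (- g (x, y)) * indicator D y" for y
        using ind[of y "- g (x, y)"] by simp
      have I: "integrable (m x) (\<lambda>y. indicator D y * g (x, y))"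
        unfolding real_integrable_def using f True meas by (auto simp: P_def ind e)
      then have "(\<integral> y. indicator D y * g (x, y) \<partial>m x) = enn2real (P 1 x) - enn2real (P (-1) x)"
        by (subst real_lebesgue_integral_def) (auto simp: P_def True ind e)
      then show ?thesis
        using I True by (simp add: set_integrable_def set_lebesgue_integral_def)
    qed (simp add: P_def)
  qed
  have P_int: "integrable \<nu> (\<lambda>x. enn2real (P s x))"
    and P_eq: "(\<integral> x. enn2real (P s x) \<partial>\<nu>) = enn2real (\<integral>\<^sup>+ z. ennreal (s * g z) \<partial>\<mu>)" for s
  proof -
    have *: "(\<integral>\<^sup>+ x. ennreal (enn2real (P s x)) \<partial>\<nu>) = (\<integral>\<^sup>+ x. P s x \<partial>\<nu>)"
      using AE_fin[of s] by (intro nn_integral_cong_AE) (auto simp: less_top)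
    show "integrable \<nu> (\<lambda>x. enn2real (P s x))"
      using fin[of s] by (intro integrableI_nonneg) (auto simp: *)
    show "(\<integral> x. enn2real (P s x) \<partial>\<nu>) = enn2real (\<integral>\<^sup>+ z. ennreal (s * g z) \<partial>\<mu>)"
      by (subst integral_eq_nn_integral) (auto simp: * int_P)
  qed
  have [measurable]: "(\<lambda>x. indicator D x * (LINT y : D | m x. g (x, y))) \<in> borel_measurable \<nu>"
    unfolding set_lebesgue_integral_def
    by (intro borel_measurable_times borel_measurable_integral_kernel) measurable
  show "AE x in \<nu>. x \<in> D \<longrightarrow> set_integrable (m x) D (\<lambda>y. g (x, y))"
    using key by auto
  show "integrable \<nu> (\<lambda>x. indicator D x * (LINT y : D | m x. g (x, y)))"
  proof (rule integrable_cong_AE_imp)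
    show "integrable \<nu> (\<lambda>x. enn2real (P 1 x) - enn2real (P (-1) x))"
      using P_int by simp
    show "AE x in \<nu>. enn2real (P 1 x) - enn2real (P (-1) x) = indicator D x * (LINT y : D | m x. g (x, y))"
      using key by auto
  qed measurable
  have "(\<integral> z. g z \<partial>\<mu>) = enn2real (\<integral>\<^sup>+ x. P 1 x \<partial>\<nu>) - enn2real (\<integral>\<^sup>+ x. P (-1) x \<partial>\<nu>)"
    using real_lebesgue_integral_def[OF g] int_P[of 1] int_P[of "-1"] by simp
  also have "\<dots> = (\<integral> x. enn2real (P 1 x) - enn2real (P (-1) x) \<partial>\<nu>)"
    using P_int P_eq int_P by simp
  also have "\<dots> = (\<integral> x. indicator D x * (LINT y : D | m x. g (x, y)) \<partial>\<nu>)"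
    using key by (intro integral_cong_AE) auto
  finally show "(\<integral> z. g z \<partial>\<mu>) = (\<integral> x. indicator D x * (LINT y : D | m x. g (x, y)) \<partial>\<nu>)" .
qed

text \<open>By reversibility this says that points outside the closure do not jump into \<open>\<Omega>\<close>.\<close>

lemma AE_walk_in_closure: "AE x in \<nu>. x \<in> \<Omega> \<longrightarrow> emeasure (m x) (space \<nu> - D) = 0"
proof -
  have "(\<integral>\<^sup>+ x. \<integral>\<^sup>+ y. indicator \<Omega> x * indicator (space \<nu> - D) y \<partial>m x \<partial>\<nu>)
      = (\<integral>\<^sup>+ z. indicator \<Omega> (fst z) * indicator (space \<nu> - D) (snd z) \<partial>W)"
    by (subst nn_integral_W) auto
  also have "\<dots> = (\<integral>\<^sup>+ z. indicator \<Omega> (snd z) * indicator (space \<nu> - D) (fst z) \<partial>W)"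
    by (subst nn_integral_W_swap[symmetric]) auto
  also have "\<dots> = (\<integral>\<^sup>+ x. \<integral>\<^sup>+ y. indicator (space \<nu> - D) x * indicator \<Omega> y \<partial>m x \<partial>\<nu>)"
    by (subst nn_integral_W) (auto simp: mult.commute)
  also have "\<dots> = (\<integral>\<^sup>+ x. 0 \<partial>\<nu>)"
  proof (rule nn_integral_cong)
    fix x assume x: "x \<in> space \<nu>"
    have "(\<integral>\<^sup>+ y. indicator (space \<nu> - D) x * indicator \<Omega> y \<partial>m x)
        = indicator (space \<nu> - D) x * emeasure (m x) \<Omega>"
      by (rule nn_integral_cmult_indicator) (simp add: sets_m[OF x])
    also have "\<dots> = 0"
      using x by (auto simp: m_closure_def m_boundary_def split: split_indicator)
    finally show "(\<integral>\<^sup>+ y. indicator (space \<nu> - D) x * indicator \<Omega> y \<partial>m x) = 0" .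
  qed
  also have "\<dots> = 0" by simp
  finally have "AE x in \<nu>. (\<integral>\<^sup>+ y. indicator \<Omega> x * indicator (space \<nu> - D) y \<partial>m x) = 0"
    by (subst (asm) nn_integral_0_iff_AE)
      (auto intro!: nn_integral_measurable_subprob_algebra2[where N = \<nu>])
  then show ?thesis
    using AE_space
  proof eventually_elim
    fix x assume *: "(\<integral>\<^sup>+ y. indicator \<Omega> x * indicator (space \<nu> - D) y \<partial>m x) = 0" and x: "x \<in> space \<nu>"
    have "(\<integral>\<^sup>+ y. indicator \<Omega> x * indicator (space \<nu> - D) y \<partial>m x)
        = indicator \<Omega> x * emeasure (m x) (space \<nu> - D)"
      by (rule nn_integral_cmult_indicator) (simp add: sets_m[OF x])
    then show "x \<in> \<Omega> \<longrightarrow> emeasure (m x) (space \<nu> - D) = 0" using * by auto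
  qed
qed

text \<open>The perimeter lets the walk jump anywhere outside E, whereas \<mu> sees only jumps
  within \<open>D\<close>. Nothing is lost, since from a.e. point of \<Omega> the walk stays in
  \<open>D\<close> with probability one.\<close>

lemma perimeter_eq:
  assumes E[measurable]: "E \<in> sets \<nu>" and "E \<subseteq> \<Omega>"
  shows "perimeter \<nu> m E = (\<integral>\<^sup>+ z. indicator E (fst z) * indicator (- E) (snd z) \<partial>\<mu>)"
proof -
  have [measurable]: "Measurable.pred \<nu> (\<lambda>x. x \<in> E)" by measurable
  have "(\<integral>\<^sup>+ z. indicator E (fst z) * indicator (- E) (snd z) \<partial>\<mu>)
      = (\<integral>\<^sup>+ x \<in> D. (\<integral>\<^sup>+ y \<in> D. indicator E x * indicator (- E) y \<partial>m x) \<partial>\<nu>)"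
    by (subst nn_integral_\<mu>_iterated) (auto simp: indicator_compl)
  also have "\<dots> = (\<integral>\<^sup>+ x \<in> E. emeasure (m x) (space \<nu> - E) \<partial>\<nu>)"
  proof (rule nn_integral_cong_AE)
    show "AE x in \<nu>. (\<integral>\<^sup>+ y \<in> D. indicator E x * indicator (- E) y \<partial>m x) * indicator D x
        = emeasure (m x) (space \<nu> - E) * indicator E x"
      using AE_walk_in_closure AE_space
    proof eventually_elim
      fix x assume *: "x \<in> \<Omega> \<longrightarrow> emeasure (m x) (space \<nu> - D) = 0" and x: "x \<in> space \<nu>"
      show "(\<integral>\<^sup>+ y \<in> D. indicator E x * indicator (- E) y \<partial>m x) * indicator D x
        = emeasure (m x) (space \<nu> - E) * indicator E x"
      proof (cases "x \<in> E")
        case True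
        then have xD: "x \<in> \<Omega>" "x \<in> D" using assms(2) \<Omega>_D by auto
        have "(\<integral>\<^sup>+ y \<in> D. indicator E x * indicator (- E) y \<partial>m x) = (\<integral>\<^sup>+ y. indicator (D - E) y \<partial>m x)"
          using True by (intro nn_integral_cong) (auto split: split_indicator)
        also have "\<dots> = emeasure (m x) (D - E)"
          using sets_m[OF x] by (simp)
        also have "\<dots> = emeasure (m x) (space \<nu> - E)"
        proof (rule emeasure_eq_AE)
          have "AE y in m x. y \<in> D"
            using * xD sets_m[OF x] space_m[OF x]
            by (intro AE_I[of _ _ "space \<nu> - D"]) auto
          then show "AE y in m x. (y \<in> D - E) = (y \<in> space \<nu> - E)"
            using AE_space by eventually_elim (auto simp: space_m[OF x])
        qed (simp_all add: sets_m[OF x])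
        finally show ?thesis using True xD by simp
      qed simp
    qed
  qed
  finally show ?thesis by (simp add: perimeter_def interaction_def)
qed

end

section \<open>Minimizers of the torsion energy\<close>

lemma integrable_abs_of_powr:
  fixes f :: "'a \<Rightarrow> real"
  assumes "integrable M (\<lambda>x. \<bar>f x\<bar> powr p)" "f \<in> borel_measurable M" "A \<in> sets M"
    "emeasure M A < \<infinity>" "\<And>x. x \<notin> A \<Longrightarrow> f x = 0" "p > 1"
  shows "integrable M f"
proof (rule Bochner_Integration.integrable_bound)
  show "integrable M (\<lambda>x. \<bar>f x\<bar> powr p + indicator A x)"
    using assms by (intro Bochner_Integration.integrable_add integrable_real_indicator) auto
  show "AE x in M. norm (f x) \<le> norm (\<bar>f x\<bar> powr p + indicator A x)"
  proof (rule AE_I2)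
    fix x show "norm (f x) \<le> norm (\<bar>f x\<bar> powr p + indicator A x)"
      using abs_le_powr_plus[OF assms(6), of 1 "f x"] assms(5)[of x]
      by (cases "x \<in> A") auto
  qed
qed fact

text \<open>Fatou's lemma. The bounds vary with n because the energies along a minimizing sequence
  are bounded only in terms of the integrals of its members, which themselves converge.\<close>

lemma nn_integral_abs_powr_limit_le:
  fixes f :: "nat \<Rightarrow> 'b \<Rightarrow> real"
  assumes [measurable]: "\<And>n. f n \<in> borel_measurable M" and "p > 0"
    and lim: "AE x in M. (\<lambda>n. f n x) \<longlonglongrightarrow> g x"
    and le: "\<And>n. (\<integral>\<^sup>+ x. ennreal (\<bar>f n x\<bar> powr p) \<partial>M) \<le> ennreal (b n)" and b: "b \<longlonglongrightarrow> \<beta>"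
  shows "(\<integral>\<^sup>+ x. ennreal (\<bar>g x\<bar> powr p) \<partial>M) \<le> ennreal \<beta>"
proof -
  have "(\<integral>\<^sup>+ x. ennreal (\<bar>g x\<bar> powr p) \<partial>M) = (\<integral>\<^sup>+ x. liminf (\<lambda>n. ennreal (\<bar>f n x\<bar> powr p)) \<partial>M)"
  proof (rule nn_integral_cong_AE)
    show "AE x in M. ennreal (\<bar>g x\<bar> powr p) = liminf (\<lambda>n. ennreal (\<bar>f n x\<bar> powr p))"
      using lim
    proof eventually_elim
      fix x assume "(\<lambda>n. f n x) \<longlonglongrightarrow> g x"
      then have "(\<lambda>n. ennreal (\<bar>f n x\<bar> powr p)) \<longlonglongrightarrow> ennreal (\<bar>g x\<bar> powr p)"
        using \<open>p > 0\<close> by (intro tendsto_ennrealI tendsto_powr' tendsto_rabs tendsto_const) auto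
      then show "ennreal (\<bar>g x\<bar> powr p) = liminf (\<lambda>n. ennreal (\<bar>f n x\<bar> powr p))"
        using lim_imp_Liminf[OF sequentially_bot] by metis
    qed
  qed
  also have "\<dots> \<le> liminf (\<lambda>n. \<integral>\<^sup>+ x. ennreal (\<bar>f n x\<bar> powr p) \<partial>M)"
    by (rule nn_integral_liminf) measurable
  also have "\<dots> \<le> liminf (\<lambda>n. ennreal (b n))"
    using le by (intro Liminf_mono) auto
  also have "\<dots> = ennreal \<beta>"
    using b by (intro lim_imp_Liminf tendsto_ennrealI) auto
  finally show ?thesis .
qed

section \<open>The space of admissible functions and their energy\<close>

context walk_domain
begin

text \<open>Representatives of L^p_0 normalised to vanish at every point outside \<Omega>, including
  points outside \<open>D\<close>, so that integrals over \<Omega> and over the whole space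
  agree.\<close>

definition V :: "real \<Rightarrow> ('a \<Rightarrow> real) set" where
  "V p = {u \<in> borel_measurable \<nu>. (\<forall>x. x \<notin> \<Omega> \<longrightarrow> u x = 0) \<and> integrable \<nu> (\<lambda>x. \<bar>u x\<bar> powr p)}"

definition energy :: "real \<Rightarrow> ('a \<Rightarrow> real) \<Rightarrow> real" where
  "energy p u = (\<integral> z. \<bar>u (snd z) - u (fst z)\<bar> powr p \<partial>\<mu>)"

text \<open>In the weight 1 / (2 p), the p cancels the factor from differentiating the power and the
  2 cancels the double counting of pairs; the Euler-Lagrange equation is then the torsion equation
  with right-hand side exactly 1.\<close>

definition torsion_energy :: "real \<Rightarrow> ('a \<Rightarrow> real) \<Rightarrow> real" where
  "torsion_energy p u = energy p u / (2 * p) - (\<integral> x. u x \<partial>\<nu>)"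

lemma V_measurable[measurable_dest]: "u \<in> V p \<Longrightarrow> u \<in> borel_measurable \<nu>"
  by (simp add: V_def)

lemma V_outside: "u \<in> V p \<Longrightarrow> x \<notin> \<Omega> \<Longrightarrow> u x = 0"
  by (simp add: V_def)

lemma V_powr_integrable: "u \<in> V p \<Longrightarrow> integrable \<nu> (\<lambda>x. \<bar>u x\<bar> powr p)"
  by (simp add: V_def)

lemma V_integrable:
  assumes "u \<in> V p" "p > 1"
  shows "integrable \<nu> u"
  by (rule integrable_abs_of_powr[where p = p and A = \<Omega>]) (use assms \<Omega>_fin in \<open>auto simp: V_def\<close>)

lemma integrable_\<mu>_fst_snd:
  fixes g :: "'a \<Rightarrow> real"
  assumes g: "integrable \<nu> g"
  shows "integrable \<mu> (\<lambda>z. g (fst z))" "integrable \<mu> (\<lambda>z. g (snd z))"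
proof -
  have [measurable]: "g \<in> borel_measurable \<nu>" using g by auto
  have "(\<integral>\<^sup>+ x \<in> D. ennreal (norm (g x)) \<partial>\<nu>) \<le> (\<integral>\<^sup>+ x. ennreal (norm (g x)) \<partial>\<nu>)"
    by (intro nn_integral_mono) (auto split: split_indicator)
  also have "\<dots> < \<infinity>" using g by (simp add: integrable_iff_bounded)
  finally have fin: "(\<integral>\<^sup>+ x \<in> D. ennreal (norm (g x)) \<partial>\<nu>) < \<infinity>" .
  have "(\<integral>\<^sup>+ z. ennreal (norm (g (fst z))) \<partial>\<mu>) < \<infinity>"
    using nn_integral_\<mu>_fst_le[of "\<lambda>x. ennreal (norm (g x))"] fin by (simp add: le_less_trans)
  then show "integrable \<mu> (\<lambda>z. g (fst z))" by (intro integrableI_bounded) auto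
  then show "integrable \<mu> (\<lambda>z. g (snd z))"
    using integral_\<mu>_swap(2)[of "\<lambda>z. g (fst z)"] by simp
qed

lemma V_powr_integrable_\<mu>:
  assumes "u \<in> V p"
  shows "integrable \<mu> (\<lambda>z. \<bar>u (fst z)\<bar> powr p)" "integrable \<mu> (\<lambda>z. \<bar>u (snd z)\<bar> powr p)"
  using integrable_\<mu>_fst_snd[OF V_powr_integrable[OF assms]] by auto

lemma V_grad_integrable:
  assumes u: "u \<in> V p" and "p > 0"
  shows "integrable \<mu> (\<lambda>z. \<bar>u (snd z) - u (fst z)\<bar> powr p)"
proof (rule Bochner_Integration.integrable_bound)
  note [measurable] = V_measurable[OF u]
  show "integrable \<mu> (\<lambda>z. 2 powr p * (\<bar>u (snd z)\<bar> powr p + \<bar>u (fst z)\<bar> powr p))"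
    using V_powr_integrable_\<mu>[OF u] by simp
  show "(\<lambda>z. \<bar>u (snd z) - u (fst z)\<bar> powr p) \<in> borel_measurable \<mu>" by measurable
qed (use abs_powr_diff_le[OF \<open>p > 0\<close>] in auto)

lemma nn_integral_grad_eq_energy:
  assumes u: "u \<in> V p" and "p > 0"
  shows "(\<integral>\<^sup>+ z. ennreal (\<bar>u (snd z) - u (fst z)\<bar> powr p) \<partial>\<mu>) = ennreal (energy p u)"
  unfolding energy_def using V_grad_integrable[OF assms] by (intro nn_integral_eq_integral) auto

lemma energy_nonneg: "0 \<le> energy p u"
  unfolding energy_def by (intro integral_nonneg_AE) auto

lemma V_lincomb:
  assumes u: "u \<in> V p" and v: "v \<in> V p" and "p > 0"
  shows "(\<lambda>x. a * u x + b * v x) \<in> V p"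
proof -
  note [measurable] = V_measurable[OF u] V_measurable[OF v]
  have "integrable \<nu> (\<lambda>x. \<bar>a * u x + b * v x\<bar> powr p)"
  proof (rule Bochner_Integration.integrable_bound)
    show "integrable \<nu> (\<lambda>x. 2 powr p * (\<bar>a\<bar> powr p * \<bar>u x\<bar> powr p + \<bar>b\<bar> powr p * \<bar>v x\<bar> powr p))"
      using V_powr_integrable[OF u] V_powr_integrable[OF v] by simp
    show "AE x in \<nu>. norm (\<bar>a * u x + b * v x\<bar> powr p)
        \<le> norm (2 powr p * (\<bar>a\<bar> powr p * \<bar>u x\<bar> powr p + \<bar>b\<bar> powr p * \<bar>v x\<bar> powr p))"
      using abs_powr_diff_le[OF \<open>p > 0\<close>, of "a * u x" "- (b * v x)" for x]
      by (intro AE_I2) (simp add: abs_mult powr_mult)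
  qed measurable
  then show ?thesis
    using V_outside[OF u] V_outside[OF v] by (auto simp: V_def)
qed

lemma V_diff: "u \<in> V p \<Longrightarrow> v \<in> V p \<Longrightarrow> p > 0 \<Longrightarrow> (\<lambda>x. u x - v x) \<in> V p"
  using V_lincomb[of u p v 1 "-1"] by simp

lemma V_abs: "u \<in> V p \<Longrightarrow> (\<lambda>x. \<bar>u x\<bar>) \<in> V p"
  by (auto simp: V_def)

lemma V_indicator:
  assumes [measurable]: "A \<in> sets \<nu>" and "A \<subseteq> \<Omega>"
  shows "indicator A \<in> V p"
proof -
  have "emeasure \<nu> A < \<infinity>"
    using emeasure_mono[OF assms(2) \<Omega>_sets] \<Omega>_fin by (rule le_less_trans)
  then have "integrable \<nu> (indicator A :: 'a \<Rightarrow> real)" by simp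
  moreover have "(\<lambda>x. \<bar>indicator A x\<bar> powr p) = (indicator A :: 'a \<Rightarrow> real)"
    by (auto simp: fun_eq_iff split: split_indicator)
  ultimately show ?thesis
    using assms(2) by (auto simp: V_def split: split_indicator)
qed

lemma V_Lp0: "u \<in> V p \<Longrightarrow> u \<in> Lp0_fun p \<nu> m \<Omega>"
proof -
  assume u: "u \<in> V p"
  note [measurable] = V_measurable[OF u]
  have "integrable (restrict_space \<nu> D) (\<lambda>x. \<bar>u x\<bar> powr p)"
    by (subst integrable_restrict_space)
      (auto intro!: integrable_real_mult_indicator V_powr_integrable[OF u] simp: mult.commute)
  moreover have "u \<in> borel_measurable (restrict_space \<nu> D)"
    by (intro measurable_restrict_space1) measurable
  moreover have "u x = 0" if "x \<in> m_boundary \<nu> m \<Omega>" for x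
    using that V_outside[OF u] by (auto simp: m_boundary_def)
  ultimately show ?thesis by (auto simp: Lp0_fun_def Lp_fun_def)
qed

lemma poincare_V:
  assumes "poincare p \<nu> m \<Omega>" "p > 0"
  obtains c where "c > 0" "\<And>u. u \<in> V p \<Longrightarrow> c * (\<integral> x. \<bar>u x\<bar> powr p \<partial>\<nu>) \<le> energy p u"
proof -
  obtain c where c: "c > 0" and P: "\<And>f. f \<in> Lp0_fun p \<nu> m \<Omega> \<Longrightarrow>
     ennreal c * (\<integral>\<^sup>+ x \<in> \<Omega>. ennreal (\<bar>f x\<bar> powr p) \<partial>\<nu>)
       \<le> (\<integral>\<^sup>+ z \<in> D \<times> D. ennreal (\<bar>f (snd z) - f (fst z)\<bar> powr p) \<partial>W)"
    using assms(1) by (auto simp: poincare_def)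
  show ?thesis
  proof (rule that[OF c])
    fix u assume u: "u \<in> V p"
    note [measurable] = V_measurable[OF u]
    have "ennreal (c * (\<integral> x. \<bar>u x\<bar> powr p \<partial>\<nu>)) = ennreal c * (\<integral>\<^sup>+ x. ennreal (\<bar>u x\<bar> powr p) \<partial>\<nu>)"
      using c V_powr_integrable[OF u] by (subst nn_integral_eq_integral) (auto simp: ennreal_mult)
    also have "(\<integral>\<^sup>+ x. ennreal (\<bar>u x\<bar> powr p) \<partial>\<nu>) = (\<integral>\<^sup>+ x \<in> \<Omega>. ennreal (\<bar>u x\<bar> powr p) \<partial>\<nu>)"
      using V_outside[OF u] by (intro nn_integral_cong) (auto split: split_indicator)
    also have "ennreal c * \<dots> \<le> (\<integral>\<^sup>+ z \<in> D \<times> D. ennreal (\<bar>u (snd z) - u (fst z)\<bar> powr p) \<partial>W)"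
      by (rule P[OF V_Lp0[OF u]])
    also have "\<dots> = ennreal (energy p u)"
      by (subst nn_integral_grad_eq_energy[OF u assms(2), symmetric], subst nn_integral_\<mu>) auto
    finally show "c * (\<integral> x. \<bar>u x\<bar> powr p \<partial>\<nu>) \<le> energy p u"
      using energy_nonneg by (simp add: ennreal_le_iff)
  qed
qed

end

section \<open>Existence of a minimizer by the direct method\<close>

locale torsion_problem = walk_domain +
  fixes p c :: real
  assumes p: "p > 1" and c: "c > 0"
    and poincare_c: "\<And>u. u \<in> V p \<Longrightarrow> c * (\<integral> x. \<bar>u x\<bar> powr p \<partial>\<nu>) \<le> energy p u"
begin

lemma p0: "p > 0" using p by simp

lemma coercive:
  obtains K where "K \<ge> 0" "\<And>u. u \<in> V p \<Longrightarrow> energy p u / (4 * p) - K \<le> torsion_energy p u"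
proof -
  \<comment> \<open>With this weight the Poincare inequality absorbs the linear term into half of
    \<open>energy p u / (2 * p)\<close>, and the other half survives.\<close>
  define \<delta> where "\<delta> = c / (4 * p)"
  define k where "k = (1 / \<delta>) powr (1 / (p - 1))"
  have \<delta>: "\<delta> > 0" using c p by (simp add: \<delta>_def)
  show ?thesis
  proof (rule that[of "k * measure \<nu> \<Omega>"])
    show "k * measure \<nu> \<Omega> \<ge> 0" by (simp add: k_def)
    fix u assume u: "u \<in> V p"
    have i: "integrable \<nu> (\<lambda>x. k * indicator \<Omega> x :: real)"
      using \<Omega>_fin by (intro integrable_mult_right integrable_real_indicator) auto
    have "(\<integral> x. u x \<partial>\<nu>) \<le> (\<integral> x. \<delta> * \<bar>u x\<bar> powr p + k * indicator \<Omega> x \<partial>\<nu>)"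
    proof (rule integral_mono)
      show "integrable \<nu> u" using V_integrable[OF u p] .
      show "integrable \<nu> (\<lambda>x. \<delta> * \<bar>u x\<bar> powr p + k * indicator \<Omega> x)"
        using i V_powr_integrable[OF u] by simp
      fix x
      show "u x \<le> \<delta> * \<bar>u x\<bar> powr p + k * indicator \<Omega> x"
        using abs_le_powr_plus[OF p \<delta>, of "u x"] V_outside[OF u, of x]
        by (cases "x \<in> \<Omega>") (auto simp: k_def)
    qed
    also have "\<dots> = \<delta> * (\<integral> x. \<bar>u x\<bar> powr p \<partial>\<nu>) + k * measure \<nu> \<Omega>"
      using i V_powr_integrable[OF u] sets.Int_space_eq2[OF \<Omega>_sets] by simp
    also have "\<delta> * (\<integral> x. \<bar>u x\<bar> powr p \<partial>\<nu>) \<le> energy p u / (4 * p)"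
      using poincare_c[OF u] p by (simp add: \<delta>_def field_simps)
    finally have "(\<integral> x. u x \<partial>\<nu>) \<le> energy p u / (4 * p) + k * measure \<nu> \<Omega>" by simp
    moreover have "energy p u / (2 * p) = energy p u / (4 * p) + energy p u / (4 * p)" by simp
    ultimately show "energy p u / (4 * p) - k * measure \<nu> \<Omega> \<le> torsion_energy p u"
      unfolding torsion_energy_def by linarith
  qed
qed

definition Jmin :: real where "Jmin = Inf (torsion_energy p ` V p)"

lemma V_zero: "(\<lambda>x. 0) \<in> V p"
  by (simp add: V_def)

lemma Jmin_le: "u \<in> V p \<Longrightarrow> Jmin \<le> torsion_energy p u"
proof -
  obtain K where K: "K \<ge> 0" "\<And>u. u \<in> V p \<Longrightarrow> energy p u / (4 * p) - K \<le> torsion_energy p u"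
    by (rule coercive) blast
  have "- K \<le> torsion_energy p u" if "u \<in> V p" for u
    using K(2)[OF that] energy_nonneg[of p u] p divide_nonneg_pos[of "energy p u" "4 * p"] by linarith
  then have "bdd_below (torsion_energy p ` V p)" by (auto simp: bdd_below_def)
  then show "u \<in> V p \<Longrightarrow> Jmin \<le> torsion_energy p u"
    unfolding Jmin_def by (intro cInf_lower) auto
qed

text \<open>The midpoint of u and v cannot fall below \<open>Jmin\<close>, so the convexity gap of
  the energy at u and v is at most 2 p \<delta>. Integrated uniform convexity then makes the energy
  of u - v small, and the Poincare inequality turns this into smallness in L^p.\<close>

lemma near_minimizers_close:
  assumes "\<eta> > 0"
  obtains \<delta> where "\<delta> > 0"
    "\<And>u v. u \<in> V p \<Longrightarrow> v \<in> V p \<Longrightarrow> torsion_energy p u \<le> Jmin + \<delta> \<Longrightarrow> torsion_energy p v \<le> Jmin + \<delta> \<Longrightarrow>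
       (\<integral> x. \<bar>u x - v x\<bar> powr p \<partial>\<nu>) \<le> \<eta>"
proof -
  obtain K where K: "K \<ge> 0" "\<And>u. u \<in> V p \<Longrightarrow> energy p u / (4 * p) - K \<le> torsion_energy p u"
    by (rule coercive) blast
  \<comment> \<open>By coercivity, a bound on the energy of every function within 1 of the infimum;
    hence \<delta> \<le> 1 below.\<close>
  define B where "B = max 1 (4 * p * (Jmin + 1 + K))"
  have B: "B > 0" by (simp add: B_def)
  \<comment> \<open>\<epsilon> and \<delta> are balanced so that 2 \<epsilon> B and 2 p C \<delta>
    each contribute at most c \<eta> / 2.\<close>
  define \<epsilon> where "\<epsilon> = c * \<eta> / (4 * B)"
  have \<epsilon>: "\<epsilon> > 0" using c B assms by (simp add: \<epsilon>_def)
  obtain C where C: "C > 0" "\<And>a b. \<bar>a - b\<bar> powr p \<le> \<epsilon> * (\<bar>a\<bar> powr p + \<bar>b\<bar> powr p)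
        + C * ((\<bar>a\<bar> powr p + \<bar>b\<bar> powr p) / 2 - \<bar>(a + b) / 2\<bar> powr p)"
    by (rule abs_powr_uniformly_convex[OF p \<epsilon>]) blast
  define \<delta> where "\<delta> = min 1 (c * \<eta> / (4 * p * C))"
  show ?thesis
  proof (rule that[of \<delta>])
    show "\<delta> > 0" using c C p assms by (simp add: \<delta>_def)
    fix u v assume u: "u \<in> V p" and v: "v \<in> V p"
      and Ju: "torsion_energy p u \<le> Jmin + \<delta>" and Jv: "torsion_energy p v \<le> Jmin + \<delta>"
    define w where "w = (\<lambda>x. 1/2 * u x + 1/2 * v x)"
    have w: "w \<in> V p" unfolding w_def using u v p by (intro V_lincomb) auto
    have d: "(\<lambda>x. u x - v x) \<in> V p" using u v p by (intro V_diff) auto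
    note iu = V_grad_integrable[OF u p0] and iv = V_grad_integrable[OF v p0] and iw = V_grad_integrable[OF w p0]
    have bound: "energy p f \<le> B" if "f \<in> V p" "torsion_energy p f \<le> Jmin + \<delta>" for f
    proof -
      have "energy p f / (4 * p) \<le> Jmin + 1 + K"
        using K(2)[OF that(1)] that(2) by (auto simp: \<delta>_def)
      then have "energy p f \<le> 4 * p * (Jmin + 1 + K)" using p by (simp add: field_simps)
      then show ?thesis by (simp add: B_def)
    qed
    have "energy p (\<lambda>x. u x - v x) \<le>
        (\<integral> z. \<epsilon> * (\<bar>u (snd z) - u (fst z)\<bar> powr p + \<bar>v (snd z) - v (fst z)\<bar> powr p)
        + C * ((\<bar>u (snd z) - u (fst z)\<bar> powr p + \<bar>v (snd z) - v (fst z)\<bar> powr p) / 2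
          - \<bar>w (snd z) - w (fst z)\<bar> powr p) \<partial>\<mu>)"
      unfolding energy_def
    proof (rule integral_mono)
      show "integrable \<mu> (\<lambda>z. \<bar>u (snd z) - v (snd z) - (u (fst z) - v (fst z))\<bar> powr p)"
        using V_grad_integrable[OF d p0] .
      show "integrable \<mu> (\<lambda>z. \<epsilon> * (\<bar>u (snd z) - u (fst z)\<bar> powr p + \<bar>v (snd z) - v (fst z)\<bar> powr p)
        + C * ((\<bar>u (snd z) - u (fst z)\<bar> powr p + \<bar>v (snd z) - v (fst z)\<bar> powr p) / 2
          - \<bar>w (snd z) - w (fst z)\<bar> powr p))"
        using iu iv iw by auto
      fix z
      have e1: "w (snd z) - w (fst z) = (u (snd z) - u (fst z) + (v (snd z) - v (fst z))) / 2"
        by (simp add: w_def field_simps)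
      have e2: "u (snd z) - v (snd z) - (u (fst z) - v (fst z))
          = u (snd z) - u (fst z) - (v (snd z) - v (fst z))" by simp
      show "\<bar>u (snd z) - v (snd z) - (u (fst z) - v (fst z))\<bar> powr p
        \<le> \<epsilon> * (\<bar>u (snd z) - u (fst z)\<bar> powr p + \<bar>v (snd z) - v (fst z)\<bar> powr p)
        + C * ((\<bar>u (snd z) - u (fst z)\<bar> powr p + \<bar>v (snd z) - v (fst z)\<bar> powr p) / 2
          - \<bar>w (snd z) - w (fst z)\<bar> powr p)"
        unfolding e1 e2 by (rule C(2))
    qed
    also have "\<dots> = \<epsilon> * (energy p u + energy p v) + C * ((energy p u + energy p v) / 2 - energy p w)"
      unfolding energy_def using iu iv iw by simp
    \<comment> \<open>The linear terms cancel because w is the midpoint.\<close>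
    also have "(energy p u + energy p v) / 2 - energy p w
        = 2 * p * ((torsion_energy p u + torsion_energy p v) / 2 - torsion_energy p w)"
    proof -
      have "(\<integral> x. w x \<partial>\<nu>) = ((\<integral> x. u x \<partial>\<nu>) + (\<integral> x. v x \<partial>\<nu>)) / 2"
        using V_integrable[OF u p] V_integrable[OF v p] by (simp add: w_def field_simps)
      then show ?thesis using p by (simp add: torsion_energy_def field_simps)
    qed
    also have "\<epsilon> * (energy p u + energy p v) + C * (2 * p * ((torsion_energy p u + torsion_energy p v) / 2 - torsion_energy p w))
        \<le> \<epsilon> * (B + B) + C * (2 * p * \<delta>)"
    proof (intro add_mono mult_left_mono)
      show "(torsion_energy p u + torsion_energy p v) / 2 - torsion_energy p w \<le> \<delta>"
        using Ju Jv Jmin_le[OF w] by (simp add: field_simps)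
    qed (use bound[OF u Ju] bound[OF v Jv] less_imp_le[OF \<epsilon>] C(1) p in auto)
    also have "\<dots> \<le> \<epsilon> * (B + B) + C * (2 * p * (c * \<eta> / (4 * p * C)))"
      using C(1) p by (intro add_left_mono mult_left_mono) (auto simp: \<delta>_def)
    also have "\<dots> = c * \<eta>"
      using B C p by (simp add: \<epsilon>_def)
    finally have "c * (\<integral> x. \<bar>u x - v x\<bar> powr p \<partial>\<nu>) \<le> c * \<eta>"
      using poincare_c[OF d] by linarith
    then show "(\<integral> x. \<bar>u x - v x\<bar> powr p \<partial>\<nu>) \<le> \<eta>"
      using c by simp
  qed
qed

text \<open>Consecutive members differ by at most 2^(-n) in the L^p norm, a summable rate, so that
  the sequence itself converges a.e. without passing to a subsequence.\<close>

lemma minimizing_sequence: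
  obtains u where "\<And>n. u n \<in> V p" "\<And>n. torsion_energy p (u n) \<le> Jmin + 1 / real (Suc n)"
    "\<And>n. (\<integral> x. \<bar>u (Suc n) x - u n x\<bar> powr p \<partial>\<nu>) \<le> ((1/2) ^ n) powr p"
proof -
  define R where "R n \<delta> \<longleftrightarrow> (\<forall>u\<in>V p. \<forall>v\<in>V p. torsion_energy p u \<le> Jmin + \<delta> \<longrightarrow>
      torsion_energy p v \<le> Jmin + \<delta> \<longrightarrow> (\<integral> x. \<bar>u x - v x\<bar> powr p \<partial>\<nu>) \<le> ((1/2) ^ n) powr p)"
    for n :: nat and \<delta> :: real
  have "\<exists>\<delta>>0. R n \<delta>" for n
  proof (rule near_minimizers_close)
    show "((1/2) ^ n) powr p > 0" by simp
  qed (auto simp: R_def)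
  then obtain \<delta> where \<delta>: "\<And>n. \<delta> n > 0" "\<And>n. R n (\<delta> n)"
    by metis
  \<comment> \<open>The minimum over all earlier thresholds lets both u_n and its successor satisfy
    the threshold of level n.\<close>
  define \<rho> where "\<rho> n = min (1 / real (Suc n)) (Min (\<delta> ` {..n}))" for n
  have \<rho>: "\<rho> n > 0" "\<rho> n \<le> 1 / real (Suc n)" "k \<le> n \<Longrightarrow> \<rho> n \<le> \<delta> k" for n k
    using \<delta>(1) by (auto simp: \<rho>_def min_le_iff_disj)
  have "\<exists>u. u \<in> V p \<and> torsion_energy p u \<le> Jmin + \<rho> n" for n
  proof -
    have "Inf (torsion_energy p ` V p) < Jmin + \<rho> n" using \<rho>(1)[of n] by (simp add: Jmin_def)
    then obtain e where "e \<in> torsion_energy p ` V p" "e < Jmin + \<rho> n"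
      using cInf_lessD[of "torsion_energy p ` V p"] V_zero by blast
    then show ?thesis by (auto intro: less_imp_le)
  qed
  then obtain u where u: "\<And>n. u n \<in> V p" "\<And>n. torsion_energy p (u n) \<le> Jmin + \<rho> n"
    by metis
  show ?thesis
  proof (rule that[of u])
    show "torsion_energy p (u n) \<le> Jmin + 1 / real (Suc n)" for n
      using u(2)[of n] \<rho>(2)[of n] by linarith
    show "(\<integral> x. \<bar>u (Suc n) x - u n x\<bar> powr p \<partial>\<nu>) \<le> ((1/2) ^ n) powr p" for n
    proof -
      have "torsion_energy p (u n) \<le> Jmin + \<delta> n" "torsion_energy p (u (Suc n)) \<le> Jmin + \<delta> n"
        using u(2)[of n] u(2)[of "Suc n"] \<rho>(3)[of n n] \<rho>(3)[of n "Suc n"] by auto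
      then show ?thesis using \<delta>(2)[of n] u(1) by (simp add: R_def)
    qed
  qed (rule u)
qed

text \<open>Riesz-Fischer argument: the increments are summable in L^1, so the telescoping series
  converges a.e. and its integrals converge too. The linear term thus passes to the limit exactly,
  and Fatou's lemma handles the energy.\<close>

lemma minimizer_exists: "\<exists>w\<in>V p. torsion_energy p w \<le> Jmin"
proof -
  obtain u where u: "\<And>n. u n \<in> V p" "\<And>n. torsion_energy p (u n) \<le> Jmin + 1 / real (Suc n)"
    and fast: "\<And>n. (\<integral> x. \<bar>u (Suc n) x - u n x\<bar> powr p \<partial>\<nu>) \<le> ((1/2) ^ n) powr p"
    by (rule minimizing_sequence) blast
  note [measurable] = V_measurable[OF u(1)]
  define d where "d n x = u (Suc n) x - u n x" for n x
  have dV: "d n \<in> V p" for n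
    unfolding d_def[abs_def] using u p by (intro V_diff) auto
  note d_int = V_integrable[OF dV p]
  have [measurable]: "d n \<in> borel_measurable \<nu>" for n using V_measurable[OF dV] .
  have d_norm: "(\<integral> x. norm (d n x) \<partial>\<nu>) \<le> (1/2) ^ n * (1 + measure \<nu> \<Omega>)" for n
  proof -
    define q :: real where "q = (1/2) ^ n"
    have q: "q > 0" by (simp add: q_def)
    have i: "integrable \<nu> (\<lambda>x. q * indicator \<Omega> x :: real)"
      using \<Omega>_fin by (intro integrable_mult_right integrable_real_indicator) auto
    \<comment> \<open>The weight q^(1-p) makes the additive constant of
      \<open>abs_le_powr_plus\<close> equal to q, and it turns the L^p bound q^p into q as
      well.\<close>
    have "(\<integral> x. norm (d n x) \<partial>\<nu>) \<le> (\<integral> x. q powr (1 - p) * \<bar>d n x\<bar> powr p + q * indicator \<Omega> x \<partial>\<nu>)"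
    proof (rule integral_mono)
      show "integrable \<nu> (\<lambda>x. norm (d n x))" using d_int by simp
      show "integrable \<nu> (\<lambda>x. q powr (1 - p) * \<bar>d n x\<bar> powr p + q * indicator \<Omega> x)"
        using i V_powr_integrable[OF dV] by simp
      fix x
      have "(1 / q powr (1 - p)) = q powr (p - 1)"
        using powr_minus_divide[of q "1 - p"] by simp
      then have "(1 / q powr (1 - p)) powr (1 / (p - 1)) = q"
        using q p by (simp add: powr_powr)
      then show "norm (d n x) \<le> q powr (1 - p) * \<bar>d n x\<bar> powr p + q * indicator \<Omega> x"
        using abs_le_powr_plus[OF p, of "q powr (1 - p)" "d n x"] V_outside[OF dV, of x n] q
        by (cases "x \<in> \<Omega>") auto
    qed
    also have "\<dots> = q powr (1 - p) * (\<integral> x. \<bar>d n x\<bar> powr p \<partial>\<nu>) + q * measure \<nu> \<Omega>"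
      using i V_powr_integrable[OF dV] sets.Int_space_eq2[OF \<Omega>_sets] by simp
    also have "\<dots> \<le> q powr (1 - p) * q powr p + q * measure \<nu> \<Omega>"
      using fast[of n] by (intro add_mono mult_left_mono) (auto simp: d_def q_def)
    also have "q powr (1 - p) * q powr p = q" using q by (simp add: powr_add[symmetric])
    finally show ?thesis by (simp add: q_def algebra_simps)
  qed
  have geo: "summable (\<lambda>n. (1/2) ^ n * (1 + measure \<nu> \<Omega>))"
    by (intro summable_mult2 summable_geometric) simp
  have sum_int: "summable (\<lambda>n. \<integral> x. norm (d n x) \<partial>\<nu>)"
    by (rule summable_comparison_test'[OF geo]) (use d_norm in auto)
  have AE_sum: "AE x in \<nu>. summable (\<lambda>n. norm (d n x))"
  proof -
    have "(\<integral>\<^sup>+ x. (\<Sum>n. ennreal (norm (d n x))) \<partial>\<nu>) = (\<Sum>n. \<integral>\<^sup>+ x. ennreal (norm (d n x)) \<partial>\<nu>)"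
      by (rule nn_integral_suminf) measurable
    also have "\<dots> = (\<Sum>n. ennreal (\<integral> x. norm (d n x) \<partial>\<nu>))"
    proof (rule suminf_cong)
      fix n
      have "integrable \<nu> (\<lambda>x. norm (d n x))" using d_int[of n] by (rule integrable_norm)
      then show "(\<integral>\<^sup>+ x. ennreal (norm (d n x)) \<partial>\<nu>) = ennreal (\<integral> x. norm (d n x) \<partial>\<nu>)"
        by (intro nn_integral_eq_integral) auto
    qed
    also have "\<dots> \<noteq> \<infinity>"
      unfolding infinity_ennreal_def by (rule ennreal_suminf_neq_top[OF sum_int]) simp
    finally have "AE x in \<nu>. (\<Sum>n. ennreal (norm (d n x))) \<noteq> \<infinity>"
      by (intro nn_integral_PInf_AE) auto
    then show ?thesis
      by eventually_elim (auto intro: summable_suminf_not_top)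
  qed
  \<comment> \<open>Where the series diverges, a null set, \<open>suminf\<close> has an unspecified
    value. Outside \<Omega> all terms are 0, so w vanishes there at every point, as \<open>V\<close>
    demands.\<close>
  define w where "w x = u 0 x + (\<Sum>n. d n x)" for x
  have tele: "(\<Sum>i<n. d i x) = u n x - u 0 x" for n x
    unfolding d_def by (rule sum_lessThan_telescope)
  have w_meas[measurable]: "w \<in> borel_measurable \<nu>"
    using borel_measurable_add[OF V_measurable[OF u(1)[of 0]]
        borel_measurable_integrable[OF integrable_suminf[OF d_int AE_sum sum_int]]]
    unfolding w_def[abs_def] .
  have lim: "AE x in \<nu>. (\<lambda>n. u n x) \<longlonglongrightarrow> w x"
    using AE_sum
  proof eventually_elim
    fix x assume "summable (\<lambda>n. norm (d n x))"
    then have "(\<lambda>n. \<Sum>i<n. d i x) \<longlonglongrightarrow> (\<Sum>n. d n x)"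
      by (rule summable_LIMSEQ[OF summable_norm_cancel])
    then have "(\<lambda>n. u 0 x + (\<Sum>i<n. d i x)) \<longlonglongrightarrow> w x"
      unfolding w_def by (intro tendsto_intros)
    then show "(\<lambda>n. u n x) \<longlonglongrightarrow> w x" by (simp add: tele)
  qed
  have lim_int: "(\<lambda>n. \<integral> x. u n x \<partial>\<nu>) \<longlonglongrightarrow> (\<integral> x. w x \<partial>\<nu>)"
  proof -
    have "(\<lambda>n. \<Sum>i<n. \<integral> x. d i x \<partial>\<nu>) \<longlonglongrightarrow> (\<integral> x. (\<Sum>n. d n x) \<partial>\<nu>)"
      using sums_integral[OF d_int AE_sum sum_int] by (simp add: sums_def)
    then have "(\<lambda>n. (\<integral> x. u 0 x \<partial>\<nu>) + (\<Sum>i<n. \<integral> x. d i x \<partial>\<nu>)) \<longlonglongrightarrow> (\<integral> x. u 0 x \<partial>\<nu>) + (\<integral> x. (\<Sum>n. d n x) \<partial>\<nu>)"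
      by (intro tendsto_intros)
    moreover have "(\<integral> x. u 0 x \<partial>\<nu>) + (\<integral> x. (\<Sum>n. d n x) \<partial>\<nu>) = (\<integral> x. w x \<partial>\<nu>)"
      using integrable_suminf[OF d_int AE_sum sum_int] V_integrable[OF u(1) p] by (simp add: w_def)
    moreover have "(\<integral> x. u 0 x \<partial>\<nu>) + (\<Sum>i<n. \<integral> x. d i x \<partial>\<nu>) = (\<integral> x. u n x \<partial>\<nu>)" for n
    proof -
      have "(\<Sum>i<n. \<integral> x. d i x \<partial>\<nu>) = (\<integral> x. (\<Sum>i<n. d i x) \<partial>\<nu>)"
        using d_int by simp
      then show ?thesis using V_integrable[OF u(1) p] by (simp add: tele)
    qed
    ultimately show ?thesis by simp
  qed
  define b where "b n = 2 * p * (Jmin + 1 / real (Suc n) + (\<integral> x. u n x \<partial>\<nu>))" for n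
  define \<beta> where "\<beta> = 2 * p * (Jmin + 0 + (\<integral> x. w x \<partial>\<nu>))"
  have b_lim: "b \<longlonglongrightarrow> \<beta>"
    unfolding b_def \<beta>_def by (intro tendsto_intros lim_int LIMSEQ_Suc[OF lim_const_over_n])
  have energy_b: "energy p (u n) \<le> b n" for n
  proof -
    have "energy p (u n) = 2 * p * (torsion_energy p (u n) + (\<integral> x. u n x \<partial>\<nu>))"
      using p by (simp add: torsion_energy_def)
    also have "\<dots> \<le> b n"
      unfolding b_def using u(2)[of n] p by (intro mult_left_mono add_mono) auto
    finally show ?thesis .
  qed
  have "(\<integral>\<^sup>+ x. ennreal (\<bar>w x\<bar> powr p) \<partial>\<nu>) \<le> ennreal (\<beta> / c)"
  proof (rule nn_integral_abs_powr_limit_le[OF _ p0 lim])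
    show "(\<lambda>n. b n / c) \<longlonglongrightarrow> \<beta> / c" using c by (intro tendsto_intros b_lim) auto
    fix n
    have "(\<integral> x. \<bar>u n x\<bar> powr p \<partial>\<nu>) \<le> b n / c"
      using poincare_c[OF u(1), of n] energy_b[of n] c by (simp add: field_simps)
    then show "(\<integral>\<^sup>+ x. ennreal (\<bar>u n x\<bar> powr p) \<partial>\<nu>) \<le> ennreal (b n / c)"
      using V_powr_integrable[OF u(1)] by (subst nn_integral_eq_integral) (auto intro: ennreal_leI)
  qed measurable
  then have "(\<integral>\<^sup>+ x. ennreal (\<bar>w x\<bar> powr p) \<partial>\<nu>) < \<infinity>"
    by (rule le_less_trans) simp
  then have "integrable \<nu> (\<lambda>x. \<bar>w x\<bar> powr p)"
    by (intro integrableI_bounded) auto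
  moreover have "w x = 0" if "x \<notin> \<Omega>" for x
    using V_outside[OF dV that] V_outside[OF u(1) that] by (simp add: w_def)
  ultimately have w: "w \<in> V p" by (auto simp: V_def)
  have "(\<integral>\<^sup>+ z. ennreal (\<bar>w (snd z) - w (fst z)\<bar> powr p) \<partial>\<mu>) \<le> ennreal \<beta>"
  proof (rule nn_integral_abs_powr_limit_le[OF _ p0 _ _ b_lim])
    show "AE z in \<mu>. (\<lambda>n. u n (snd z) - u n (fst z)) \<longlonglongrightarrow> w (snd z) - w (fst z)"
      using AE_\<mu>_fst_snd[OF lim] by eventually_elim (auto intro: tendsto_diff)
    show "(\<integral>\<^sup>+ z. ennreal (\<bar>u n (snd z) - u n (fst z)\<bar> powr p) \<partial>\<mu>) \<le> ennreal (b n)" for n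
      unfolding nn_integral_grad_eq_energy[OF u(1) p0] using energy_b by (rule ennreal_leI)
  qed measurable
  then have le: "ennreal (energy p w) \<le> ennreal \<beta>"
    unfolding nn_integral_grad_eq_energy[OF w p0] .
  \<comment> \<open>\<open>ennreal\<close> sends negative numbers to 0, so the comparison returns to
    the reals only once the sign of \<beta> is known.\<close>
  have "0 \<le> \<beta>"
    by (rule LIMSEQ_le_const[OF b_lim]) (use order_trans[OF energy_nonneg energy_b] in auto)
  with le have "energy p w \<le> \<beta>" by (simp add: ennreal_le_iff)
  then have "energy p w / (2 * p) \<le> \<beta> / (2 * p)"
    using p by (intro divide_right_mono) auto
  then have "torsion_energy p w \<le> Jmin"
    using p by (simp add: \<beta>_def torsion_energy_def)
  with w show ?thesis by blast
qed

text \<open>Passing to the absolute value does not increase differences, hence not the energy, and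
  does not decrease the integral.\<close>

lemma nonneg_minimizer_exists:
  obtains w where "w \<in> V p" "\<And>x. 0 \<le> w x" "\<And>v. v \<in> V p \<Longrightarrow> torsion_energy p w \<le> torsion_energy p v"
proof -
  obtain w where w: "w \<in> V p" "torsion_energy p w \<le> Jmin" using minimizer_exists by blast
  have aw: "(\<lambda>x. \<bar>w x\<bar>) \<in> V p" by (rule V_abs[OF w(1)])
  have "energy p (\<lambda>x. \<bar>w x\<bar>) \<le> energy p w"
    unfolding energy_def using V_grad_integrable[OF w(1) p0] V_grad_integrable[OF aw p0] p
    by (intro integral_mono) (auto intro!: powr_mono2)
  moreover have "(\<integral> x. w x \<partial>\<nu>) \<le> (\<integral> x. \<bar>w x\<bar> \<partial>\<nu>)"
    using V_integrable[OF w(1) p] by (intro integral_mono) auto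
  ultimately have "torsion_energy p (\<lambda>x. \<bar>w x\<bar>) \<le> torsion_energy p w"
    unfolding torsion_energy_def using p by (intro diff_mono divide_right_mono) auto
  then have "torsion_energy p (\<lambda>x. \<bar>w x\<bar>) \<le> torsion_energy p v" if "v \<in> V p" for v
    using w(2) Jmin_le[OF that] by linarith
  then show ?thesis using that[OF aw] by auto
qed

end

section \<open>The torsion equation\<close>

context walk_domain
begin

definition flux :: "real \<Rightarrow> ('a \<Rightarrow> real) \<Rightarrow> 'a \<times> 'a \<Rightarrow> real" where
  "flux p u z = \<bar>u (snd z) - u (fst z)\<bar> powr (p - 2) * (u (snd z) - u (fst z))"

definition plaplace :: "real \<Rightarrow> ('a \<Rightarrow> real) \<Rightarrow> 'a \<Rightarrow> real" where
  "plaplace p u x = (LINT y : D | m x. \<bar>u y - u x\<bar> powr (p - 2) * (u y - u x))"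

lemma flux_measurable[measurable]:
  assumes [measurable]: "u \<in> borel_measurable \<nu>"
  shows "flux p u \<in> borel_measurable (\<nu> \<Otimes>\<^sub>M \<nu>)"
  unfolding flux_def[abs_def] by measurable

lemma flux_swap: "flux p u (snd z, fst z) = - flux p u z"
  unfolding flux_def by (simp add: abs_minus_commute algebra_simps)

lemma flux_mult_le:
  assumes "p > 1"
  shows "\<bar>flux p u z * t\<bar> \<le> (1 - 1 / p) * \<bar>u (snd z) - u (fst z)\<bar> powr p + \<bar>t\<bar> powr p / p"
  using Young_powr[OF assms, of "\<bar>u (snd z) - u (fst z)\<bar>" "\<bar>t\<bar>"]
  by (simp add: flux_def abs_mult[of _ t] abs_powr_mult_self)

lemma flux_mult_integrable:
  assumes u: "u \<in> V p" and "p > 1" and h[measurable]: "h \<in> borel_measurable (\<nu> \<Otimes>\<^sub>M \<nu>)"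
    and h_int: "integrable \<mu> (\<lambda>z. \<bar>h z\<bar> powr p)"
  shows "integrable \<mu> (\<lambda>z. flux p u z * h z)"
proof (rule Bochner_Integration.integrable_bound)
  note [measurable] = V_measurable[OF u]
  show "integrable \<mu> (\<lambda>z. (1 - 1 / p) * \<bar>u (snd z) - u (fst z)\<bar> powr p + \<bar>h z\<bar> powr p / p)"
    using V_grad_integrable[OF u] h_int \<open>p > 1\<close> by simp
  show "AE z in \<mu>. norm (flux p u z * h z)
      \<le> norm ((1 - 1 / p) * \<bar>u (snd z) - u (fst z)\<bar> powr p + \<bar>h z\<bar> powr p / p)"
  proof (rule AE_I2)
    fix z show "norm (flux p u z * h z)
      \<le> norm ((1 - 1 / p) * \<bar>u (snd z) - u (fst z)\<bar> powr p + \<bar>h z\<bar> powr p / p)"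
      using flux_mult_le[OF \<open>p > 1\<close>, of u z "h z"] by simp
  qed
  have "(\<lambda>z. flux p u z * h z) \<in> borel_measurable (\<nu> \<Otimes>\<^sub>M \<nu>)"
    by (intro borel_measurable_times flux_measurable V_measurable[OF u] h)
  then show "(\<lambda>z. flux p u z * h z) \<in> borel_measurable \<mu>"
    by (simp add: measurable_cong_sets[OF sets_\<mu> refl])
qed

text \<open>Integration by parts: symmetry of \<open>\<mu>\<close> against antisymmetry of the flux.\<close>

lemma flux_weak:
  assumes u: "u \<in> V p" and v: "v \<in> V p" and "p > 1"
  shows "integrable \<nu> (\<lambda>x. v x * plaplace p u x)"
    and "(\<integral> z. flux p u z * (v (snd z) - v (fst z)) \<partial>\<mu>) = - 2 * (\<integral> x. v x * plaplace p u x \<partial>\<nu>)"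
proof -
  note [measurable] = V_measurable[OF u] V_measurable[OF v]
  have i1: "integrable \<mu> (\<lambda>z. flux p u z * v (fst z))"
    using V_powr_integrable_\<mu>[OF v] by (intro flux_mult_integrable[OF u \<open>p > 1\<close>]) auto
  have i2: "integrable \<mu> (\<lambda>z. flux p u z * v (snd z))"
    using V_powr_integrable_\<mu>[OF v] by (intro flux_mult_integrable[OF u \<open>p > 1\<close>]) auto
  have sw: "(\<integral> z. flux p u z * v (snd z) \<partial>\<mu>) = - (\<integral> z. flux p u z * v (fst z) \<partial>\<mu>)"
    using integral_\<mu>_swap(1)[of "\<lambda>z. flux p u z * v (fst z)"]
    by (simp add: flux_swap)
  have eq: "indicator D x * (LINT y : D | m x. flux p u (x, y) * v (fst (x, y))) = v x * plaplace p u x" for x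
  proof -
    have "(LINT y : D | m x. flux p u (x, y) * v (fst (x, y))) = v x * plaplace p u x"
      by (simp add: plaplace_def flux_def mult.commute[of _ "v x"])
    then show ?thesis
      using V_outside[OF v, of x] \<Omega>_D by (auto split: split_indicator)
  qed
  show "integrable \<nu> (\<lambda>x. v x * plaplace p u x)"
    using integral_\<mu>_iterated(2)[OF i1] unfolding eq .
  have "(\<integral> z. flux p u z * (v (snd z) - v (fst z)) \<partial>\<mu>)
      = (\<integral> z. flux p u z * v (snd z) \<partial>\<mu>) - (\<integral> z. flux p u z * v (fst z) \<partial>\<mu>)"
    using i1 i2 by (simp add: right_diff_distrib)
  also have "\<dots> = - 2 * (\<integral> z. flux p u z * v (fst z) \<partial>\<mu>)"
    unfolding sw by simp
  also have "(\<integral> z. flux p u z * v (fst z) \<partial>\<mu>) = (\<integral> x. v x * plaplace p u x \<partial>\<nu>)"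
    using integral_\<mu>_iterated(3)[OF i1] unfolding eq .
  finally show "(\<integral> z. flux p u z * (v (snd z) - v (fst z)) \<partial>\<mu>) = - 2 * (\<integral> x. v x * plaplace p u x \<partial>\<nu>)" .
qed

end

text \<open>The directional derivative taken along the steps 1 / (n + 1), since dominated
  convergence is applied to sequences.\<close>

lemma abs_powr_quot_limit:
  fixes a b p :: real
  assumes "p > 1"
  shows "(\<lambda>n. (\<bar>a + 1 / real (Suc n) * b\<bar> powr p - \<bar>a\<bar> powr p) / (1 / real (Suc n)))
    \<longlonglongrightarrow> p * (\<bar>a\<bar> powr (p - 2) * a * b)"
proof -
  have "((\<lambda>s. \<bar>a + s * b\<bar> powr p) has_real_derivative p * (\<bar>a + 0 * b\<bar> powr (p - 2) * (a + 0 * b)) * b) (at 0)"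
    by (rule DERIV_chain2[where g = "\<lambda>s. a + s * b", OF DERIV_abs_powr[OF assms]])
      (auto intro!: derivative_eq_intros)
  then have "((\<lambda>h. (\<bar>a + (0 + h) * b\<bar> powr p - \<bar>a + 0 * b\<bar> powr p) / h) \<longlongrightarrow> p * (\<bar>a\<bar> powr (p - 2) * a * b)) (at 0)"
    by (simp add: DERIV_def mult.assoc)
  moreover have "filterlim (\<lambda>n. 1 / real (Suc n)) (at 0) sequentially"
    using LIMSEQ_Suc[OF lim_const_over_n[of "1::real"]] by (rule filterlim_atI) auto
  ultimately show ?thesis
    by (auto dest: filterlim_compose)
qed

section \<open>First variation and the Euler-Lagrange equation\<close>

context torsion_problem
begin

text \<open>Compare w with w + t v for small t > 0, divide by t and let t tend to 0 under the
  integral. Positive steps give one inequality; the reverse one follows by applying it to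
  -v.\<close>

lemma minimizer_variation:
  assumes w: "w \<in> V p" and min: "\<And>v. v \<in> V p \<Longrightarrow> torsion_energy p w \<le> torsion_energy p v" and v: "v \<in> V p"
  shows "2 * (\<integral> x. v x \<partial>\<nu>) \<le> (\<integral> z. flux p w z * (v (snd z) - v (fst z)) \<partial>\<mu>)"
proof -
  note [measurable] = V_measurable[OF w] V_measurable[OF v]
  define a where "a z = w (snd z) - w (fst z)" for z
  define b where "b z = v (snd z) - v (fst z)" for z
  define t where "t n = 1 / real (Suc n)" for n
  have t: "t n > 0" "t n \<le> 1" for n by (auto simp: t_def)
  have [measurable]: "a \<in> borel_measurable (\<nu> \<Otimes>\<^sub>M \<nu>)" "b \<in> borel_measurable (\<nu> \<Otimes>\<^sub>M \<nu>)"
    unfolding a_def[abs_def] b_def[abs_def] by measurable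
  define q where "q n z = (\<bar>a z + t n * b z\<bar> powr p - \<bar>a z\<bar> powr p) / t n" for n z
  have ai: "integrable \<mu> (\<lambda>z. \<bar>a z\<bar> powr p)" and bi: "integrable \<mu> (\<lambda>z. \<bar>b z\<bar> powr p)"
    unfolding a_def b_def using V_grad_integrable[OF w p0] V_grad_integrable[OF v p0] by auto
  have lim: "(\<lambda>n. \<integral> z. q n z \<partial>\<mu>) \<longlonglongrightarrow> (\<integral> z. p * (\<bar>a z\<bar> powr (p - 2) * a z * b z) \<partial>\<mu>)"
  proof (rule integral_dominated_convergence)
    \<comment> \<open>For t \<le> 1 the mean value bound on the quotient is at most p (|a| + |b|)^p,
      which does not depend on t.\<close>
    show "integrable \<mu> (\<lambda>z. p * (2 powr p * (\<bar>a z\<bar> powr p + \<bar>b z\<bar> powr p)))"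
      using ai bi by simp
    show "AE z in \<mu>. (\<lambda>n. q n z) \<longlonglongrightarrow> p * (\<bar>a z\<bar> powr (p - 2) * a z * b z)"
      unfolding q_def t_def using abs_powr_quot_limit[OF p] by (intro AE_I2)
    show "AE z in \<mu>. norm (q n z) \<le> p * (2 powr p * (\<bar>a z\<bar> powr p + \<bar>b z\<bar> powr p))" for n
    proof (rule AE_I2)
      fix z
      have "\<bar>\<bar>a z + t n * b z\<bar> powr p - \<bar>a z\<bar> powr p\<bar> \<le> p * \<bar>t n * b z\<bar> * (\<bar>a z\<bar> + \<bar>t n * b z\<bar>) powr (p - 1)"
        by (rule abs_powr_diff_quot_le[OF p])
      also have "\<dots> \<le> p * (t n * (\<bar>a z\<bar> + \<bar>b z\<bar>)) * (\<bar>a z\<bar> + \<bar>b z\<bar>) powr (p - 1)"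
        using p t[of n] by (intro mult_mono powr_mono2 mult_left_mono)
          (auto simp: abs_mult mult_left_le_one_le intro!: add_nonneg_nonneg)
      also have "\<dots> = t n * (p * (\<bar>a z\<bar> + \<bar>b z\<bar>) powr p)"
        by (cases "\<bar>a z\<bar> + \<bar>b z\<bar> = 0") (auto simp: powr_diff)
      also have "\<dots> \<le> t n * (p * (2 powr p * (\<bar>a z\<bar> powr p + \<bar>b z\<bar> powr p)))"
        using p t(1)[of n] abs_powr_add_le[OF p0] by (intro mult_left_mono) auto
      finally show "norm (q n z) \<le> p * (2 powr p * (\<bar>a z\<bar> powr p + \<bar>b z\<bar> powr p))"
        using t(1)[of n] by (simp add: q_def field_simps)
    qed
    show "(\<lambda>z. p * (\<bar>a z\<bar> powr (p - 2) * a z * b z)) \<in> borel_measurable \<mu>" by measurable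
    show "q n \<in> borel_measurable \<mu>" for n unfolding q_def[abs_def] by measurable
  qed
  have ge: "2 * p * (\<integral> x. v x \<partial>\<nu>) \<le> (\<integral> z. q n z \<partial>\<mu>)" for n
  proof -
    define y where "y = (\<lambda>x. 1 * w x + t n * v x)"
    have y: "y \<in> V p" unfolding y_def using w v p0 by (rule V_lincomb)
    have ey: "y (snd z) - y (fst z) = a z + t n * b z" for z
      by (simp add: y_def a_def b_def algebra_simps)
    have yi: "integrable \<mu> (\<lambda>z. \<bar>a z + t n * b z\<bar> powr p)"
      using V_grad_integrable[OF y p0] unfolding ey .
    have "(\<integral> z. q n z \<partial>\<mu>) = (energy p y - energy p w) / t n"
      unfolding q_def energy_def ey using ai yi by (simp add: a_def)
    moreover have "(\<integral> x. y x \<partial>\<nu>) = (\<integral> x. w x \<partial>\<nu>) + t n * (\<integral> x. v x \<partial>\<nu>)"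
      using V_integrable[OF w p] V_integrable[OF v p] by (simp add: y_def)
    with min[OF y] have "energy p w / (2 * p) + t n * (\<integral> x. v x \<partial>\<nu>) \<le> energy p y / (2 * p)"
      by (simp add: torsion_energy_def)
    then have "2 * p * (energy p w / (2 * p) + t n * (\<integral> x. v x \<partial>\<nu>)) \<le> 2 * p * (energy p y / (2 * p))"
      using p by (intro mult_left_mono) auto
    then have "2 * p * (t n * (\<integral> x. v x \<partial>\<nu>)) \<le> energy p y - energy p w"
      using p by (simp add: distrib_left)
    then have "2 * p * (t n * (\<integral> x. v x \<partial>\<nu>)) / t n \<le> (energy p y - energy p w) / t n"
      using t(1)[of n] by (intro divide_right_mono) auto
    ultimately show ?thesis using t(1)[of n] by simp
  qed
  have "2 * p * (\<integral> x. v x \<partial>\<nu>) \<le> (\<integral> z. p * (\<bar>a z\<bar> powr (p - 2) * a z * b z) \<partial>\<mu>)"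
    by (rule LIMSEQ_le_const[OF lim]) (use ge in auto)
  also have "\<dots> = p * (\<integral> z. flux p w z * (v (snd z) - v (fst z)) \<partial>\<mu>)"
    by (simp add: a_def b_def flux_def)
  finally show ?thesis using p by simp
qed

text \<open>Testing the weak equation with the indicator of A \<inter> \<Omega>, for every
  measurable A, identifies two integrable functions by their integrals and so yields the equation at
  a.e. point of \<Omega>.\<close>

lemma torsional_exists: "\<exists>f. is_torsional p \<nu> m \<Omega> f"
proof -
  obtain w where w: "w \<in> V p" and w0: "\<And>x. 0 \<le> w x"
    and min: "\<And>v. v \<in> V p \<Longrightarrow> torsion_energy p w \<le> torsion_energy p v"
    by (rule nonneg_minimizer_exists) blast
  note [measurable] = V_measurable[OF w]
  have EL: "(\<integral> x. v x \<partial>\<nu>) = - (\<integral> x. v x * plaplace p w x \<partial>\<nu>)" if v: "v \<in> V p" for v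
  proof -
    have nv: "(\<lambda>x. - v x) \<in> V p" using V_lincomb[OF v v p0, of "-1" 0] by simp
    have "(\<integral> x. v x \<partial>\<nu>) \<le> - (\<integral> x. v x * plaplace p w x \<partial>\<nu>)"
      using minimizer_variation[OF w min v] flux_weak(2)[OF w v p] by simp
    moreover have "- (\<integral> x. v x \<partial>\<nu>) \<le> (\<integral> x. v x * plaplace p w x \<partial>\<nu>)"
      using minimizer_variation[OF w min nv] flux_weak(2)[OF w nv p] by simp
    ultimately show ?thesis by simp
  qed
  have \<Omega>V: "indicator \<Omega> \<in> V p" by (rule V_indicator) auto
  have "AE x in \<nu>. indicator \<Omega> x = - (indicator \<Omega> x * plaplace p w x)"
  proof (rule density_unique_real)
    show "integrable \<nu> (indicator \<Omega> :: _ \<Rightarrow> real)" using V_integrable[OF \<Omega>V p] .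
    show "integrable \<nu> (\<lambda>x. - (indicator \<Omega> x * plaplace p w x))"
      using flux_weak(1)[OF w \<Omega>V p] by simp
    fix A assume [measurable]: "A \<in> sets \<nu>"
    have AV: "indicator (A \<inter> \<Omega>) \<in> V p" by (rule V_indicator) auto
    show "(LINT x : A | \<nu>. indicator \<Omega> x) = (LINT x : A | \<nu>. - (indicator \<Omega> x * plaplace p w x))"
      using EL[OF AV] by (simp add: set_lebesgue_integral_def indicator_inter_arith mult.assoc)
  qed
  then have "AE x in \<nu>. x \<in> \<Omega> \<longrightarrow> - plaplace p w x = 1"
    by eventually_elim auto
  then have "is_torsional p \<nu> m \<Omega> w"
    using w0 by (simp add: is_torsional_def V_Lp0[OF w] plaplace_def)
  then show ?thesis by blast
qed

end

section \<open>Normalised representatives of torsional functions\<close>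

context walk_domain
begin

text \<open>A torsional function is controlled only a.e. in \<open>D\<close> and is arbitrary
  elsewhere. Replacing it by an a.e. equal member of \<open>V\<close> makes the energy methods
  available; \<open>AE_m\<close> ensures that the equation survives the change.\<close>

lemma torsional_representative:
  assumes f: "is_torsional p \<nu> m \<Omega> f" and "p > 1"
  obtains u where "u \<in> V p" "\<And>x. 0 \<le> u x" "(LINT x : \<Omega> | \<nu>. f x) = (\<integral> x. u x \<partial>\<nu>)"
    "AE x in \<nu>. x \<in> \<Omega> \<longrightarrow> plaplace p u x = -1"
proof -
  \<comment> \<open>f is measurable only on \<open>D\<close>; extension by zero makes it measurable
    on the whole space. The absolute value in \<open>u\<close> then gives nonnegativity at every
    point.\<close>
  define g where "g x = indicator D x *\<^sub>R f x" for x
  define u where "u x = indicator \<Omega> x * \<bar>g x\<bar>" for x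
  have D': "D \<inter> space \<nu> \<in> sets \<nu>" by simp
  have fL: "f \<in> borel_measurable (restrict_space \<nu> D)" "integrable (restrict_space \<nu> D) (\<lambda>x. \<bar>f x\<bar> powr p)"
    and fb: "AE x in \<nu>. x \<in> m_boundary \<nu> m \<Omega> \<longrightarrow> f x = 0"
    and f0: "AE x in \<nu>. x \<in> D \<longrightarrow> f x \<ge> 0"
    and feq: "AE x in \<nu>. x \<in> \<Omega> \<longrightarrow> - (LINT y : D | m x. \<bar>f y - f x\<bar> powr (p - 2) * (f y - f x)) = 1"
    using f by (auto simp: is_torsional_def Lp0_fun_def Lp_fun_def)
  have g[measurable]: "g \<in> borel_measurable \<nu>"
    using fL(1) unfolding borel_measurable_restrict_space_iff[OF D'] g_def[abs_def] .
  have u_meas[measurable]: "u \<in> borel_measurable \<nu>" unfolding u_def[abs_def] by measurable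
  have gD: "x \<in> D \<Longrightarrow> g x = f x" for x by (simp add: g_def)
  have "integrable \<nu> (\<lambda>x. \<bar>u x\<bar> powr p)"
  proof (rule Bochner_Integration.integrable_bound)
    show "integrable \<nu> (\<lambda>x. indicator D x *\<^sub>R \<bar>f x\<bar> powr p)"
      using fL(2) unfolding integrable_restrict_space[OF D'] .
    show "AE x in \<nu>. norm (\<bar>u x\<bar> powr p) \<le> norm (indicator D x *\<^sub>R \<bar>f x\<bar> powr p)"
      using \<Omega>_D by (intro AE_I2) (auto simp: u_def g_def split: split_indicator)
  qed measurable
  then have uV: "u \<in> V p" by (auto simp: V_def u_def)
  have uf: "AE x in \<nu>. x \<in> D \<longrightarrow> u x = f x"
    using fb f0
    by eventually_elim (auto simp: u_def g_def m_closure_def m_boundary_def split: split_indicator)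
  have int_eq: "(LINT x : \<Omega> | \<nu>. f x) = (\<integral> x. u x \<partial>\<nu>)"
  proof -
    have "(LINT x : \<Omega> | \<nu>. f x) = (\<integral> x. indicator \<Omega> x * g x \<partial>\<nu>)"
      unfolding set_lebesgue_integral_def
      using \<Omega>_D by (intro Bochner_Integration.integral_cong) (auto simp: g_def split: split_indicator)
    also have "\<dots> = (\<integral> x. u x \<partial>\<nu>)"
    proof (rule integral_cong_AE)
      show "AE x in \<nu>. indicator \<Omega> x * g x = u x"
        using uf by eventually_elim (use \<Omega>_D in \<open>auto simp: g_def u_def split: split_indicator\<close>)
    qed measurable
    finally show ?thesis .
  qed
  have "AE x in \<nu>. x \<in> \<Omega> \<longrightarrow> plaplace p u x = -1"
    using AE_m[OF uf] feq uf AE_space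
  proof eventually_elim
    fix x assume 1: "x \<in> D \<longrightarrow> (AE y in m x. y \<in> D \<longrightarrow> y \<in> D \<longrightarrow> u y = f y)"
      and 2: "x \<in> \<Omega> \<longrightarrow> - (LINT y : D | m x. \<bar>f y - f x\<bar> powr (p - 2) * (f y - f x)) = 1"
      and 3: "x \<in> D \<longrightarrow> u x = f x" and x: "x \<in> space \<nu>"
    show "x \<in> \<Omega> \<longrightarrow> plaplace p u x = -1"
    proof
      assume x\<Omega>: "x \<in> \<Omega>"
      then have xD: "x \<in> D" using \<Omega>_D by auto
      have "plaplace p u x = (\<integral> y. indicator D y * (\<bar>u y - f x\<bar> powr (p - 2) * (u y - f x)) \<partial>m x)"
        using 3 xD by (simp add: plaplace_def set_lebesgue_integral_def)
      also have "\<dots> = (\<integral> y. indicator D y * (\<bar>g y - f x\<bar> powr (p - 2) * (g y - f x)) \<partial>m x)"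
      proof (rule integral_cong_AE)
        show "AE y in m x. indicator D y * (\<bar>u y - f x\<bar> powr (p - 2) * (u y - f x))
            = indicator D y * (\<bar>g y - f x\<bar> powr (p - 2) * (g y - f x))"
          using 1[rule_format, OF xD] by eventually_elim (auto simp: gD split: split_indicator)
      qed (auto intro!: borel_measurable_m[OF x])
      also have "\<dots> = (LINT y : D | m x. \<bar>f y - f x\<bar> powr (p - 2) * (f y - f x))"
        unfolding set_lebesgue_integral_def
        by (intro Bochner_Integration.integral_cong) (auto simp: gD split: split_indicator)
      finally show "plaplace p u x = -1" using 2 x\<Omega> by simp
    qed
  qed
  moreover have "0 \<le> u x" for x by (simp add: u_def)
  ultimately show ?thesis using that[OF uV _ int_eq] by blast
qed

section \<open>Torsional rigidity and the Cheeger constants\<close>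

text \<open>The difference of an indicator has modulus 1 exactly on pairs that cross between E and
  its complement, and 0 elsewhere, whatever p is. By symmetry the two directions of crossing
  contribute equally.\<close>

lemma indicator_energy:
  assumes E[measurable]: "E \<in> sets \<nu>" and "E \<subseteq> \<Omega>" and "p > 1"
  shows "perimeter \<nu> m E = ennreal (energy p (indicator E) / 2)"
proof -
  have V: "indicator E \<in> V p" using assms by (intro V_indicator) auto
  define P where "P = perimeter \<nu> m E"
  have "ennreal (energy p (indicator E)) = (\<integral>\<^sup>+ z. ennreal (\<bar>indicator E (snd z) - indicator E (fst z)\<bar> powr p) \<partial>\<mu>)"
    using nn_integral_grad_eq_energy[OF V] assms(3) by simp
  also have "\<dots> = (\<integral>\<^sup>+ z. indicator E (fst z) * indicator (- E) (snd z) + indicator E (snd z) * indicator (- E) (fst z) \<partial>\<mu>)"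
    by (intro nn_integral_cong) (auto split: split_indicator)
  also have "\<dots> = (\<integral>\<^sup>+ z. indicator E (fst z) * indicator (- E) (snd z) \<partial>\<mu>)
      + (\<integral>\<^sup>+ z. indicator E (snd z) * indicator (- E) (fst z) \<partial>\<mu>)"
    by (rule nn_integral_add) (auto simp: indicator_compl)
  also have "(\<integral>\<^sup>+ z. indicator E (snd z) * indicator (- E) (fst z) \<partial>\<mu>)
      = (\<integral>\<^sup>+ z. indicator E (fst z) * indicator (- E) (snd z) \<partial>\<mu>)"
    using nn_integral_\<mu>_swap[of "\<lambda>z. indicator E (fst z) * indicator (- E) (snd z)"]
    by (simp add: indicator_compl)
  finally have eq: "ennreal (energy p (indicator E)) = P + P"
    using perimeter_eq[OF assms(1,2)] by (simp add: P_def)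
  then have "P \<noteq> \<top>" by (metis ennreal_neq_top ennreal_add_eq_top)
  then obtain r where r: "r \<ge> 0" "P = ennreal r" by (cases P) auto
  then have "energy p (indicator E) = r + r"
    using eq energy_nonneg[of p "indicator E"] by (simp add: ennreal_plus[symmetric] del: ennreal_plus)
  then show ?thesis using r by (simp add: P_def)
qed

section \<open>Consequences of the weak equation\<close>

lemma torsion_weak:
  assumes u: "u \<in> V p" and "p > 1" and eq: "AE x in \<nu>. x \<in> \<Omega> \<longrightarrow> plaplace p u x = -1" and v: "v \<in> V p"
  shows "(\<integral> z. flux p u z * (v (snd z) - v (fst z)) \<partial>\<mu>) = 2 * (\<integral> x. v x \<partial>\<nu>)"
proof -
  note [measurable] = V_measurable[OF v]
  have "(\<integral> x. v x * plaplace p u x \<partial>\<nu>) = (\<integral> x. - v x \<partial>\<nu>)"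
  proof (rule integral_cong_AE)
    show "(\<lambda>x. v x * plaplace p u x) \<in> borel_measurable \<nu>"
      using flux_weak(1)[OF u v \<open>p > 1\<close>] by auto
    show "AE x in \<nu>. v x * plaplace p u x = - v x"
      using eq by eventually_elim (use V_outside[OF v] in force)
  qed measurable
  then show ?thesis using flux_weak(2)[OF u v \<open>p > 1\<close>] by simp
qed

lemma torsion_energy_identity:
  assumes u: "u \<in> V p" and "p > 1" and eq: "AE x in \<nu>. x \<in> \<Omega> \<longrightarrow> plaplace p u x = -1"
  shows "energy p u = 2 * (\<integral> x. u x \<partial>\<nu>)"
proof -
  have "flux p u z * (u (snd z) - u (fst z)) = \<bar>u (snd z) - u (fst z)\<bar> powr p" for z
  proof -
    have "\<bar>s\<bar> powr (p - 2) * s * s = \<bar>s\<bar> powr p" for s :: real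
      by (cases "s = 0") (auto simp: powr_diff power2_eq_square)
    then show ?thesis by (simp add: flux_def)
  qed
  then show ?thesis
    using torsion_weak[OF u \<open>p > 1\<close> eq u] by (simp add: energy_def)
qed

lemma measure_pos_subset:
  assumes "E \<in> sets \<nu>" "E \<subseteq> \<Omega>" "emeasure \<nu> E > 0"
  shows "measure \<nu> E > 0" "emeasure \<nu> E = ennreal (measure \<nu> E)"
proof -
  have "emeasure \<nu> E < \<infinity>"
    using emeasure_mono[OF assms(2) \<Omega>_sets] \<Omega>_fin by (rule le_less_trans)
  then show "emeasure \<nu> E = ennreal (measure \<nu> E)" by (simp add: emeasure_eq_ennreal_measure)
  with assms(3) show "measure \<nu> E > 0" by simp
qed

text \<open>Otherwise the energy vanishes, hence the flux vanishes a.e., and testing with the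
  indicator of \<Omega> would give \<Omega> measure zero.\<close>

lemma torsion_integral_pos:
  assumes u: "u \<in> V p" and "p > 1" and eq: "AE x in \<nu>. x \<in> \<Omega> \<longrightarrow> plaplace p u x = -1"
  shows "(\<integral> x. u x \<partial>\<nu>) > 0"
proof (rule ccontr)
  assume "\<not> (\<integral> x. u x \<partial>\<nu>) > 0"
  then have "energy p u = 0"
    using torsion_energy_identity[OF assms] energy_nonneg[of p u] by linarith
  then have "AE z in \<mu>. \<bar>u (snd z) - u (fst z)\<bar> powr p = 0"
    unfolding energy_def using V_grad_integrable[OF u] \<open>p > 1\<close>
    by (subst (asm) integral_nonneg_eq_0_iff_AE) auto
  then have "AE z in \<mu>. flux p u z * (indicator \<Omega> (snd z) - indicator \<Omega> (fst z)) = 0"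
    by eventually_elim (simp add: flux_def)
  then have "(\<integral> z. flux p u z * (indicator \<Omega> (snd z) - indicator \<Omega> (fst z)) \<partial>\<mu>) = 0"
    by (rule integral_eq_zero_AE)
  moreover have "indicator \<Omega> \<in> V p" by (rule V_indicator) auto
  ultimately have "(\<integral> x. indicator \<Omega> x \<partial>\<nu>) = (0::real)"
    using torsion_weak[OF assms, of "indicator \<Omega>"] by simp
  then have "measure \<nu> \<Omega> = 0" using sets.Int_space_eq2[OF \<Omega>_sets] by simp
  then show False
    using measure_pos_subset(1)[OF \<Omega>_sets subset_refl \<Omega>_pos] by simp
qed

text \<open>This is Hoelder's inequality for the weak equation tested with v, where the factor
  containing u is known because its energy is twice its integral.\<close>

lemma torsion_holder:
  assumes u: "u \<in> V p" and "p > 1" and eq: "AE x in \<nu>. x \<in> \<Omega> \<longrightarrow> plaplace p u x = -1"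
    and v: "v \<in> V p" and pos: "(\<integral> x. v x \<partial>\<nu>) > 0"
  shows "(\<integral> x. v x \<partial>\<nu>) powr p \<le> (\<integral> x. u x \<partial>\<nu>) powr (p - 1) * (energy p v / 2)"
proof -
  note [measurable] = V_measurable[OF u] V_measurable[OF v]
  define S where "S = (\<integral> x. u x \<partial>\<nu>)"
  define B where "B = (\<integral> x. v x \<partial>\<nu>)"
  \<comment> \<open>Scaling v to the integral of u makes the left side equal to the energy 2 S of u,
    so the share 1 - 1/p of that energy on the right cancels and Young's inequality gives the sharp
    Hoelder bound.\<close>
  define l where "l = S / B"
  have S: "S > 0" unfolding S_def by (rule torsion_integral_pos[OF u \<open>p > 1\<close> eq])
  have B: "B > 0" using pos by (simp add: B_def)
  have l: "l > 0" using S B by (simp add: l_def)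
  have iu: "integrable \<mu> (\<lambda>z. \<bar>u (snd z) - u (fst z)\<bar> powr p)"
    and iv: "integrable \<mu> (\<lambda>z. \<bar>v (snd z) - v (fst z)\<bar> powr p)"
    using V_grad_integrable[OF u] V_grad_integrable[OF v] \<open>p > 1\<close> by auto
  have "l * (2 * B) = (\<integral> z. l * (flux p u z * (v (snd z) - v (fst z))) \<partial>\<mu>)"
    using torsion_weak[OF u \<open>p > 1\<close> eq v] by (simp add: B_def)
  also have "\<dots> \<le> (\<integral> z. (1 - 1 / p) * \<bar>u (snd z) - u (fst z)\<bar> powr p
      + l powr p / p * \<bar>v (snd z) - v (fst z)\<bar> powr p \<partial>\<mu>)"
  proof (rule integral_mono)
    show "integrable \<mu> (\<lambda>z. l * (flux p u z * (v (snd z) - v (fst z))))"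
      using flux_mult_integrable[OF u \<open>p > 1\<close> _ iv] by simp
    show "integrable \<mu> (\<lambda>z. (1 - 1 / p) * \<bar>u (snd z) - u (fst z)\<bar> powr p
      + l powr p / p * \<bar>v (snd z) - v (fst z)\<bar> powr p)"
      using iu iv by simp
    fix z
    show "l * (flux p u z * (v (snd z) - v (fst z))) \<le> (1 - 1 / p) * \<bar>u (snd z) - u (fst z)\<bar> powr p
      + l powr p / p * \<bar>v (snd z) - v (fst z)\<bar> powr p"
      using order_trans[OF abs_ge_self flux_mult_le[OF \<open>p > 1\<close>, of u z "l * (v (snd z) - v (fst z))"]] l
      by (simp add: abs_mult[of l] powr_mult mult_ac)
  qed
  also have "\<dots> = (1 - 1 / p) * energy p u + l powr p / p * energy p v"
    unfolding energy_def using iu iv by simp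
  also have "energy p u = 2 * S"
    using torsion_energy_identity[OF u \<open>p > 1\<close> eq] by (simp add: S_def)
  also have "l * (2 * B) = 2 * S" using B by (simp add: l_def)
  finally have "2 * S / p \<le> l powr p / p * energy p v" by (simp add: algebra_simps)
  then have "2 * S \<le> l powr p * energy p v" using \<open>p > 1\<close> by (simp add: field_simps)
  also have "\<dots> = S * S powr (p - 1) / B powr p * energy p v"
    using S B by (simp add: l_def powr_divide powr_diff)
  finally have "2 * B powr p \<le> S powr (p - 1) * energy p v"
    using S B by (simp add: field_simps)
  then show ?thesis by (simp add: S_def B_def)
qed

section \<open>Bounds on the torsional rigidity by Cheeger constants\<close>

lemma cheeger_le:
  assumes "E \<in> sets \<nu>" "E \<subseteq> \<Omega>" "emeasure \<nu> E > 0"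
  shows "cheeger p \<nu> m \<Omega> \<le> enn2real (perimeter \<nu> m E) / measure \<nu> E powr p"
  unfolding cheeger_def
  by (rule cINF_lower) (use assms in \<open>auto intro!: bdd_belowI2[where m = 0]\<close>)

lemma cheeger_geI:
  assumes "\<And>E. E \<in> sets \<nu> \<Longrightarrow> E \<subseteq> \<Omega> \<Longrightarrow> emeasure \<nu> E > 0 \<Longrightarrow>
      b \<le> enn2real (perimeter \<nu> m E) / measure \<nu> E powr p"
  shows "b \<le> cheeger p \<nu> m \<Omega>"
  unfolding cheeger_def
  by (rule cINF_greatest) (use assms \<Omega>_pos in auto)

lemma cheeger_nonneg: "0 \<le> cheeger p \<nu> m \<Omega>"
  by (rule cheeger_geI) auto

lemma torsion_upper_bound:
  assumes u: "u \<in> V p" and "p > 1" and eq: "AE x in \<nu>. x \<in> \<Omega> \<longrightarrow> plaplace p u x = -1"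
  shows "1 / (\<integral> x. u x \<partial>\<nu>) powr (p - 1) \<le> cheeger p \<nu> m \<Omega>"
proof (rule cheeger_geI)
  fix E assume E: "E \<in> sets \<nu>" "E \<subseteq> \<Omega>" "emeasure \<nu> E > 0"
  have int: "(\<integral> x. indicator E x \<partial>\<nu>) = measure \<nu> E"
    using sets.Int_space_eq2[OF E(1)] by simp
  have "measure \<nu> E powr p \<le> (\<integral> x. u x \<partial>\<nu>) powr (p - 1) * (energy p (indicator E) / 2)"
    using torsion_holder[OF assms V_indicator[OF E(1,2)]] measure_pos_subset(1)[OF E] unfolding int by simp
  also have "energy p (indicator E) / 2 = enn2real (perimeter \<nu> m E)"
    using indicator_energy[OF E(1,2) \<open>p > 1\<close>] energy_nonneg[of p "indicator E"] by simp
  finally show "1 / (\<integral> x. u x \<partial>\<nu>) powr (p - 1) \<le> enn2real (perimeter \<nu> m E) / measure \<nu> E powr p"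
    using torsion_integral_pos[OF assms] measure_pos_subset(1)[OF E] by (simp add: field_simps)
qed

lemma cheeger_perimeter:
  assumes "E \<in> sets \<nu>" "E \<subseteq> \<Omega>"
  shows "ennreal (cheeger 1 \<nu> m \<Omega>) * emeasure \<nu> E \<le> perimeter \<nu> m E"
proof (cases "emeasure \<nu> E > 0")
  case True
  note E = measure_pos_subset[OF assms True]
  have "cheeger 1 \<nu> m \<Omega> * measure \<nu> E \<le> enn2real (perimeter \<nu> m E)"
    using cheeger_le[OF assms True, of 1] E(1) by (simp add: field_simps)
  then have "ennreal (cheeger 1 \<nu> m \<Omega> * measure \<nu> E) \<le> ennreal (enn2real (perimeter \<nu> m E))"
    by (rule ennreal_leI)
  also have "\<dots> = perimeter \<nu> m E"
    \<comment> \<open>The exponent is immaterial for indicators; 2 serves only to show that the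
      perimeter is finite.\<close>
    using indicator_energy[OF assms, of 2] energy_nonneg[of 2 "indicator E"] by simp
  finally show ?thesis using E cheeger_nonneg by (simp add: ennreal_mult)
qed simp

text \<open>The coarea formula turns the isoperimetric inequality for the superlevel sets into an
  inequality for the function.\<close>

lemma cheeger_total_variation:
  assumes u: "u \<in> V p" and "p > 1" and u0: "\<And>x. 0 \<le> u x"
  shows "2 * cheeger 1 \<nu> m \<Omega> * (\<integral> x. u x \<partial>\<nu>) \<le> (\<integral> z. \<bar>u (snd z) - u (fst z)\<bar> \<partial>\<mu>)"
proof -
  note [measurable] = V_measurable[OF u]
  define h where "h = cheeger 1 \<nu> m \<Omega>"
  interpret \<nu>: sigma_finite_measure \<nu> by (rule sf)
  interpret P: pair_sigma_finite \<nu> lborel ..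
  interpret Q: pair_sigma_finite \<mu> lborel ..
  have Ico: "emeasure lborel {a..<b} = ennreal (b - a)" for a b :: real
    by (cases "a \<le> b") (auto simp: ennreal_neg)
  \<comment> \<open>The condition 0 \<le> t keeps the superlevel sets inside \<Omega>, since u
    vanishes elsewhere; negative levels give the empty set.\<close>
  define S where "S t = {x \<in> space \<nu>. 0 \<le> t \<and> t < u x}" for t
  have S: "S t \<in> sets \<nu>" "S t \<subseteq> \<Omega>" for t
  proof -
    show "S t \<in> sets \<nu>" unfolding S_def by measurable
    have "u x \<noteq> 0" if "x \<in> S t" for x using that by (simp add: S_def)
    then show "S t \<subseteq> \<Omega>" using V_outside[OF u] by blast
  qed
  have "(\<integral>\<^sup>+ x. ennreal (u x) \<partial>\<nu>) = (\<integral>\<^sup>+ x. \<integral>\<^sup>+ t. indicator {0..<u x} t \<partial>lborel \<partial>\<nu>)"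
    by (simp add: Ico)
  also have "\<dots> = (\<integral>\<^sup>+ t. \<integral>\<^sup>+ x. indicator {0..<u x} t \<partial>\<nu> \<partial>lborel)"
    by (rule P.Fubini'[symmetric]) (auto simp: indicator_def case_prod_unfold)
  also have "\<dots> = (\<integral>\<^sup>+ t. emeasure \<nu> (S t) \<partial>lborel)"
  proof (rule nn_integral_cong)
    fix t :: real
    have "(\<integral>\<^sup>+ x. indicator {0..<u x} t \<partial>\<nu>) = (\<integral>\<^sup>+ x. indicator (S t) x \<partial>\<nu>)"
      by (rule nn_integral_cong) (simp add: S_def indicator_def)
    then show "(\<integral>\<^sup>+ x. indicator {0..<u x} t \<partial>\<nu>) = emeasure \<nu> (S t)" using S(1) by simp
  qed
  finally have layer: "(\<integral>\<^sup>+ x. ennreal (u x) \<partial>\<nu>) = (\<integral>\<^sup>+ t. emeasure \<nu> (S t) \<partial>lborel)" .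
  have "(\<integral>\<^sup>+ z. ennreal (u (fst z) - u (snd z)) \<partial>\<mu>)
      = (\<integral>\<^sup>+ z. \<integral>\<^sup>+ t. indicator {u (snd z)..<u (fst z)} t \<partial>lborel \<partial>\<mu>)"
    by (simp add: Ico)
  also have "\<dots> = (\<integral>\<^sup>+ t. \<integral>\<^sup>+ z. indicator {u (snd z)..<u (fst z)} t \<partial>\<mu> \<partial>lborel)"
    by (rule Q.Fubini'[symmetric]) (auto simp: indicator_def case_prod_unfold)
  also have "\<dots> = (\<integral>\<^sup>+ t. perimeter \<nu> m (S t) \<partial>lborel)"
  proof (rule nn_integral_cong)
    fix t :: real
    show "(\<integral>\<^sup>+ z. indicator {u (snd z)..<u (fst z)} t \<partial>\<mu>) = perimeter \<nu> m (S t)"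
      unfolding perimeter_eq[OF S]
    proof (rule nn_integral_cong)
      fix z assume "z \<in> space \<mu>"
      then have "z \<in> space \<nu> \<times> space \<nu>" by simp
      then show "indicator {u (snd z)..<u (fst z)} t = (indicator (S t) (fst z) * indicator (- S t) (snd z) :: ennreal)"
        using u0[of "snd z"] by (auto simp: S_def indicator_def)
    qed
  qed
  finally have coarea: "(\<integral>\<^sup>+ z. ennreal (u (fst z) - u (snd z)) \<partial>\<mu>) = (\<integral>\<^sup>+ t. perimeter \<nu> m (S t) \<partial>lborel)" .
  have [measurable]: "(\<lambda>t. emeasure \<nu> (S t)) \<in> borel_measurable lborel"
  proof -
    have "(\<lambda>t. emeasure \<nu> (S t)) = (\<lambda>t. emeasure \<nu> (Pair t -` {w \<in> space (lborel \<Otimes>\<^sub>M \<nu>). 0 \<le> fst w \<and> fst w < u (snd w)}))"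
      by (auto simp: S_def space_pair_measure intro!: arg_cong[where f = "emeasure \<nu>"])
    also have "\<dots> \<in> borel_measurable lborel"
      by (rule \<nu>.measurable_emeasure_Pair) measurable
    finally show ?thesis .
  qed
  have "ennreal h * (\<integral>\<^sup>+ x. ennreal (u x) \<partial>\<nu>) = (\<integral>\<^sup>+ t. ennreal h * emeasure \<nu> (S t) \<partial>lborel)"
    unfolding layer by (rule nn_integral_cmult[symmetric]) measurable
  also have "\<dots> \<le> (\<integral>\<^sup>+ t. perimeter \<nu> m (S t) \<partial>lborel)"
    unfolding h_def by (intro nn_integral_mono cheeger_perimeter S)
  finally have half: "ennreal h * (\<integral>\<^sup>+ x. ennreal (u x) \<partial>\<nu>) \<le> (\<integral>\<^sup>+ z. ennreal (u (fst z) - u (snd z)) \<partial>\<mu>)"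
    unfolding coarea .
  have ui: "integrable \<nu> u" by (rule V_integrable[OF u \<open>p > 1\<close>])
  have gi: "integrable \<mu> (\<lambda>z. \<bar>u (snd z) - u (fst z)\<bar>)"
    using integrable_\<mu>_fst_snd[OF ui] by auto
  have "ennreal (h * (\<integral> x. u x \<partial>\<nu>)) \<le> (\<integral>\<^sup>+ z. ennreal (u (fst z) - u (snd z)) \<partial>\<mu>)"
    using half nn_integral_eq_integral[OF ui] u0 cheeger_nonneg by (simp add: ennreal_mult' h_def)
  \<comment> \<open>The upward and downward parts of the variation are equal by symmetry of \<mu>;
    adding them recovers the modulus and produces the factor 2.\<close>
  then have "ennreal (h * (\<integral> x. u x \<partial>\<nu>)) + ennreal (h * (\<integral> x. u x \<partial>\<nu>))
      \<le> (\<integral>\<^sup>+ z. ennreal (u (fst z) - u (snd z)) \<partial>\<mu>) + (\<integral>\<^sup>+ z. ennreal (u (snd z) - u (fst z)) \<partial>\<mu>)"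
    using nn_integral_\<mu>_swap[of "\<lambda>z. ennreal (u (fst z) - u (snd z))"] by (intro add_mono) auto
  also have "\<dots> = (\<integral>\<^sup>+ z. ennreal (u (fst z) - u (snd z)) + ennreal (u (snd z) - u (fst z)) \<partial>\<mu>)"
    by (rule nn_integral_add[symmetric]) measurable
  also have "\<dots> = (\<integral>\<^sup>+ z. ennreal \<bar>u (snd z) - u (fst z)\<bar> \<partial>\<mu>)"
    by (intro nn_integral_cong) (auto simp: abs_real_def ennreal_neg)
  also have "\<dots> = ennreal (\<integral> z. \<bar>u (snd z) - u (fst z)\<bar> \<partial>\<mu>)"
    using gi by (intro nn_integral_eq_integral) auto
  finally have sum_le: "ennreal (h * (\<integral> x. u x \<partial>\<nu>)) + ennreal (h * (\<integral> x. u x \<partial>\<nu>))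
      \<le> ennreal (\<integral> z. \<bar>u (snd z) - u (fst z)\<bar> \<partial>\<mu>)" .
  have "ennreal (h * (\<integral> x. u x \<partial>\<nu>) + h * (\<integral> x. u x \<partial>\<nu>)) \<le> ennreal (\<integral> z. \<bar>u (snd z) - u (fst z)\<bar> \<partial>\<mu>)"
  proof -
    have "0 \<le> h * (\<integral> x. u x \<partial>\<nu>)"
      using u0 cheeger_nonneg by (simp add: h_def integral_nonneg_AE)
    with sum_le show ?thesis by (simp only: ennreal_plus)
  qed
  then have "h * (\<integral> x. u x \<partial>\<nu>) + h * (\<integral> x. u x \<partial>\<nu>) \<le> (\<integral> z. \<bar>u (snd z) - u (fst z)\<bar> \<partial>\<mu>)"
    by (simp add: ennreal_le_iff integral_nonneg_AE)
  then show ?thesis by (simp add: h_def mult_ac)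
qed

lemma measure_D_pos: "measure \<nu> D > 0"
proof -
  have "0 < emeasure \<nu> D" using \<Omega>_pos emeasure_mono[OF \<Omega>_D D_sets] by (rule less_le_trans)
  then show ?thesis using closure_fin by (simp add: measure_def enn2real_positive_iff)
qed

text \<open>The total variation is at least 2 h S, and Young's inequality against a constant
  function bounds it by the energy 2 S and the mass of \<mu>, which is at most M.\<close>

lemma torsion_lower_bound:
  assumes u: "u \<in> V p" and "p > 1" and eq: "AE x in \<nu>. x \<in> \<Omega> \<longrightarrow> plaplace p u x = -1"
    and u0: "\<And>x. 0 \<le> u x"
  shows "2 powr (p - 1) * (cheeger 1 \<nu> m \<Omega> powr p / measure \<nu> D powr (p - 1))
    \<le> 1 / (\<integral> x. u x \<partial>\<nu>) powr (p - 1)"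
proof -
  note [measurable] = V_measurable[OF u]
  define h where "h = cheeger 1 \<nu> m \<Omega>"
  define S where "S = (\<integral> x. u x \<partial>\<nu>)"
  define M where "M = measure \<nu> D"
  \<comment> \<open>Chosen so that \<sigma>^p M equals the energy 2 S. The two terms of Young's
    inequality then add up to exactly 2 S, leaving \<tau> h \<le> 1, whose p-th power is the
    claim.\<close>
  define \<sigma> where "\<sigma> = (2 * S / M) powr (1 / p)"
  define \<tau> where "\<tau> = \<sigma> powr (p - 1)"
  have S: "S > 0" unfolding S_def by (rule torsion_integral_pos[OF u \<open>p > 1\<close> eq])
  have M: "M > 0" unfolding M_def by (rule measure_D_pos)
  have h: "h \<ge> 0" by (simp add: h_def cheeger_nonneg)
  have \<sigma>: "\<sigma> > 0" "\<sigma> powr p = 2 * S / M"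
    using S M \<open>p > 1\<close> by (auto simp: \<sigma>_def powr_powr)
  have \<tau>: "\<tau> > 0" using \<sigma> by (simp add: \<tau>_def)
  have iu: "integrable \<mu> (\<lambda>z. \<bar>u (snd z) - u (fst z)\<bar> powr p)"
    using V_grad_integrable[OF u] \<open>p > 1\<close> by auto
  have gi: "integrable \<mu> (\<lambda>z. \<bar>u (snd z) - u (fst z)\<bar>)"
    using integrable_\<mu>_fst_snd[OF V_integrable[OF u \<open>p > 1\<close>]] by auto
  have "\<tau> * (2 * h * S) \<le> \<tau> * (\<integral> z. \<bar>u (snd z) - u (fst z)\<bar> \<partial>\<mu>)"
    using cheeger_total_variation[OF u \<open>p > 1\<close> u0] \<tau> by (intro mult_left_mono) (auto simp: h_def S_def)
  also have "\<dots> = (\<integral> z. \<tau> * \<bar>u (snd z) - u (fst z)\<bar> \<partial>\<mu>)" by simp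
  also have "\<dots> \<le> (\<integral> z. (1 - 1 / p) * \<sigma> powr p + \<bar>u (snd z) - u (fst z)\<bar> powr p / p \<partial>\<mu>)"
  proof (rule integral_mono)
    show "integrable \<mu> (\<lambda>z. \<tau> * \<bar>u (snd z) - u (fst z)\<bar>)"
      "integrable \<mu> (\<lambda>z. (1 - 1 / p) * \<sigma> powr p + \<bar>u (snd z) - u (fst z)\<bar> powr p / p)"
      using iu gi by auto
    fix z show "\<tau> * \<bar>u (snd z) - u (fst z)\<bar> \<le> (1 - 1 / p) * \<sigma> powr p + \<bar>u (snd z) - u (fst z)\<bar> powr p / p"
      unfolding \<tau>_def using \<sigma>(1) by (intro Young_powr[OF \<open>p > 1\<close>]) auto
  qed
  also have "\<dots> = (1 - 1 / p) * \<sigma> powr p * measure \<mu> (space \<mu>) + energy p u / p"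
    unfolding energy_def using iu by simp
  also have "\<dots> \<le> (1 - 1 / p) * \<sigma> powr p * M + energy p u / p"
    using measure_\<mu>_le \<open>p > 1\<close> by (intro add_right_mono mult_left_mono mult_nonneg_nonneg) (auto simp: M_def)
  also have "\<dots> = 2 * S"
    using torsion_energy_identity[OF u \<open>p > 1\<close> eq] \<sigma>(2) M \<open>p > 1\<close>
    by (simp add: S_def field_simps)
  finally have "\<tau> * h \<le> 1" using S by (simp add: field_simps)
  then have "(\<tau> * h) powr p \<le> 1 powr p"
    using \<tau> h \<open>p > 1\<close> by (intro powr_mono2) auto
  then have "\<tau> powr p * h powr p \<le> 1"
    using \<tau> h by (simp add: powr_mult)
  also have "\<tau> powr p = (\<sigma> powr p) powr (p - 1)"
    by (simp add: \<tau>_def powr_powr mult.commute)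
  also have "\<dots> = 2 powr (p - 1) * S powr (p - 1) / M powr (p - 1)"
    unfolding \<sigma>(2) using S M by (simp add: powr_mult powr_divide)
  finally have "2 powr (p - 1) * S powr (p - 1) / M powr (p - 1) * h powr p \<le> 1" .
  then show ?thesis
    using S M by (simp add: h_def[symmetric] S_def[symmetric] M_def[symmetric] field_simps)
qed

lemma torsion_bounds:
  assumes "p > 1" "poincare p \<nu> m \<Omega>"
  shows "2 powr (p - 1) * (cheeger 1 \<nu> m \<Omega> powr p / measure \<nu> D powr (p - 1))
      \<le> 1 / torsional_rigidity p \<nu> m \<Omega>"
    and "1 / torsional_rigidity p \<nu> m \<Omega> \<le> cheeger p \<nu> m \<Omega>"
proof -
  have "p > 0" using assms by simp
  then obtain c where "c > 0" "\<And>u. u \<in> V p \<Longrightarrow> c * (\<integral> x. \<bar>u x\<bar> powr p \<partial>\<nu>) \<le> energy p u"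
    using poincare_V[OF assms(2)] by blast
  then interpret torsion_problem \<nu> m \<Omega> p c
    by unfold_locales (use assms in auto)
  \<comment> \<open>Existence turns the \<open>SOME\<close> choice into a genuine solution.\<close>
  have "is_torsional p \<nu> m \<Omega> (torsional_fun p \<nu> m \<Omega>)"
    unfolding torsional_fun_def using torsional_exists by (rule someI_ex)
  then obtain u where u: "u \<in> V p" "\<And>x. 0 \<le> u x"
    "(LINT x : \<Omega> | \<nu>. torsional_fun p \<nu> m \<Omega> x) = (\<integral> x. u x \<partial>\<nu>)"
    "AE x in \<nu>. x \<in> \<Omega> \<longrightarrow> plaplace p u x = -1"
    using torsional_representative[OF _ assms(1)] by blast
  show "2 powr (p - 1) * (cheeger 1 \<nu> m \<Omega> powr p / measure \<nu> D powr (p - 1))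
      \<le> 1 / torsional_rigidity p \<nu> m \<Omega>"
    unfolding torsional_rigidity_def u(3) by (rule torsion_lower_bound[OF u(1) assms(1) u(4,2)])
  show "1 / torsional_rigidity p \<nu> m \<Omega> \<le> cheeger p \<nu> m \<Omega>"
    unfolding torsional_rigidity_def u(3) by (rule torsion_upper_bound[OF u(1) assms(1) u(4)])
qed

section \<open>Limits as p decreases to 1\<close>

lemma cheeger_eventually_less:
  assumes "cheeger 1 \<nu> m \<Omega> < e"
  shows "\<forall>\<^sub>F p in at_right 1. cheeger p \<nu> m \<Omega> < e"
proof -
  obtain E where E: "E \<in> sets \<nu>" "E \<subseteq> \<Omega>" "emeasure \<nu> E > 0"
    and less: "enn2real (perimeter \<nu> m E) / measure \<nu> E powr 1 < e"
    using cheeger_geI[of e 1] assms by (meson not_le)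
  \<comment> \<open>A set E that is good enough at p = 1 stays so for nearby p: an infimum of
    functions continuous in p is upper semicontinuous.\<close>
  have "((\<lambda>p. enn2real (perimeter \<nu> m E) / measure \<nu> E powr p)
      \<longlongrightarrow> enn2real (perimeter \<nu> m E) / measure \<nu> E powr 1) (at_right 1)"
    using measure_pos_subset(1)[OF E] by (intro tendsto_intros) auto
  from order_tendstoD(2)[OF this less] show ?thesis
    by eventually_elim (use cheeger_le[OF E] in \<open>auto intro: le_less_trans\<close>)
qed

text \<open>The lower estimate for \<open>cheeger p\<close> comes from the torsion bounds
  themselves: \<open>low p\<close> lies below the reciprocal of the rigidity, which lies below
  \<open>cheeger p\<close>, and \<open>low\<close> tends to the Cheeger constant at 1. With both
  outer functions converging, the rigidity is squeezed between them.\<close>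

lemma torsion_limits:
  assumes "\<And>p. p > 1 \<Longrightarrow> poincare p \<nu> m \<Omega>"
  shows "((\<lambda>p. 1 / torsional_rigidity p \<nu> m \<Omega>) \<longlongrightarrow> cheeger 1 \<nu> m \<Omega>) (at_right 1)"
    and "((\<lambda>p. cheeger p \<nu> m \<Omega>) \<longlongrightarrow> cheeger 1 \<nu> m \<Omega>) (at_right 1)"
proof -
  define h where "h = cheeger 1 \<nu> m \<Omega>"
  define M where "M = measure \<nu> D"
  define low where "low p = 2 powr (p - 1) * (h powr p / M powr (p - 1))" for p
  have h: "h \<ge> 0" by (simp add: h_def cheeger_nonneg)
  have M: "M > 0" unfolding M_def by (rule measure_D_pos)
  have "(low \<longlongrightarrow> 2 powr (1 - 1) * (h powr 1 / M powr (1 - 1))) (at_right 1)"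
    unfolding low_def[abs_def] using M h by (intro tendsto_intros tendsto_powr') auto
  then have low: "(low \<longlongrightarrow> h) (at_right 1)" using M h by simp
  have bounds: "\<forall>\<^sub>F p in at_right 1. low p \<le> 1 / torsional_rigidity p \<nu> m \<Omega>
      \<and> 1 / torsional_rigidity p \<nu> m \<Omega> \<le> cheeger p \<nu> m \<Omega>"
    using eventually_at_right_less[of "1::real"]
    by eventually_elim (use torsion_bounds assms in \<open>auto simp: low_def h_def M_def\<close>)
  show "((\<lambda>p. cheeger p \<nu> m \<Omega>) \<longlongrightarrow> cheeger 1 \<nu> m \<Omega>) (at_right 1)"
  proof (rule order_tendstoI)
    fix a assume "a < cheeger 1 \<nu> m \<Omega>"
    then have "\<forall>\<^sub>F p in at_right 1. a < low p"
      using order_tendstoD(1)[OF low] by (simp add: h_def)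
    with bounds show "\<forall>\<^sub>F p in at_right 1. a < cheeger p \<nu> m \<Omega>"
      by eventually_elim auto
  qed (rule cheeger_eventually_less)
  then have up: "((\<lambda>p. cheeger p \<nu> m \<Omega>) \<longlongrightarrow> h) (at_right 1)" by (simp add: h_def)
  show "((\<lambda>p. 1 / torsional_rigidity p \<nu> m \<Omega>) \<longlongrightarrow> cheeger 1 \<nu> m \<Omega>) (at_right 1)"
    unfolding h_def[symmetric]
    by (rule tendsto_sandwich[OF _ _ low up]) (use bounds in \<open>auto elim: eventually_mono\<close>)
qed

end

theorem theorem6p8:
  fixes \<nu> :: "'a measure" and m :: "'a \<Rightarrow> 'a measure" and \<Omega> :: "'a set"
  assumes "reversible_random_walk_space \<nu> m"
    and "\<Omega> \<in> sets \<nu>"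
    and "m_connected \<nu> m \<Omega>"
    and "0 < emeasure \<nu> \<Omega>"
    and "emeasure \<nu> \<Omega> < emeasure \<nu> (m_closure \<nu> m \<Omega>)"
    and "emeasure \<nu> (m_closure \<nu> m \<Omega>) < \<infinity>"
  shows "(\<forall>p::real. p > 1 \<longrightarrow> poincare p \<nu> m \<Omega> \<longrightarrow>
            2 powr (p - 1) * (cheeger 1 \<nu> m \<Omega> powr p / measure \<nu> (m_closure \<nu> m \<Omega>) powr (p - 1))
              \<le> 1 / torsional_rigidity p \<nu> m \<Omega> \<and>
            1 / torsional_rigidity p \<nu> m \<Omega> \<le> cheeger p \<nu> m \<Omega>) \<and>
         ((\<forall>p::real. p > 1 \<longrightarrow> poincare p \<nu> m \<Omega>) \<longrightarrow>
            ((\<lambda>p. 1 / torsional_rigidity p \<nu> m \<Omega>) \<longlongrightarrow> cheeger 1 \<nu> m \<Omega>) (at_right 1) \<and>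
            ((\<lambda>p. cheeger p \<nu> m \<Omega>) \<longlongrightarrow> cheeger 1 \<nu> m \<Omega>) (at_right 1))"
proof -
  have "random_walk \<nu> m" "reversible \<nu> m" "sigma_finite_measure \<nu>"
    using assms(1) by (simp_all add: reversible_random_walk_space_def)
  then interpret walk_domain \<nu> m \<Omega>
    using assms(2,4,6) by (rule walk_domain.intro)
  show ?thesis
    using torsion_bounds torsion_limits by simp
qed

end
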